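(* Let $A$ be a finite étale $\mathbb Z_p$-algebra of rank $d$ with $p>d$. Let $\eta\in A^\times$, $\gamma\in A$, $P$ the order of $\bar\eta$ in $(A/pA)^\times$, $\eta^P=1+pU$, $\omega=\bar U$. Fix $a$, put $y_a=\gamma\eta^a$, $x_a=\bar y_a$, and assume $x_a\ne0$ and that $1,\omega,\dots,\omega^{d-1}$ is an $\mathbb F_p$-basis of $A/pA$. Let $C_{a,m}=\operatorname{Tr}_A(y_aU^m)$ and $F_a(t)=\operatorname{Tr}_A(y_a(\eta^P)^t)$, $t\in\mathbb Z_p$. Then $s_a:=\min_{0\le m\le d-1}(m+v_p(C_{a,m}))$ is finite with $0\le s_a\le d-1$; $\mathcal F_a(X)=p^{-s_a}F_a(X)\in\mathbb Z_p\langle X\rangle$ has nonzero reduction \[ \Phi_a(X)=\sum_{0\le m\le d-1,\ m+v_p(C_{a,m})=s_a}\overline{C_{a,m}/p^{s_a-m}}\binom Xm\in\mathbb F_p[X]; \] if $e_a=\deg\Phi_a$ then $e_a\le d-1$ and $F_a(X)=p^{s_a}W_a(X)V_a(X)$ with $W_a\in\mathbb Z_p[X]$ distinguished of degree $e_a$ and $V_a\in\mathbb Z_p\langle X\rangle^\times$. Hence $F_a$ has at most $d-1$ zeros in $\mathbb Z_p$ counted with Weierstrass multiplicity. If $\rho\in\mathbb F_p$ is a simple root of $\Phi_a$, there is a unique zero $\tau_\rho\in\rho+p\mathbb Z_p$ and $v_p(F_a(t))=s_a+v_p(t-\tau_\rho)$ for $t\in\rho+p\mathbb Z_p$.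
   Context: $(\eta^P)^t$ is the convergent binomial series $\sum_m\binom tm(\eta^P-1)^m$. $v_p(0)=+\infty$. Traces on $A/pA$ are over $\mathbb F_p$.
   Formalization: For p=2 (so d=1) it is also assumed that U≡0 mod 2, since otherwise F_a is not given by an element of Z_p⟨X⟩ (e.g. A=Z_2, η=−1, γ=1, F_a(t)=(−1)^t); "distinguished of degree e_a" is read as monic of degree e_a. *)

theory Defs
  imports
    "HOL-Computational_Algebra.Computational_Algebra"
    "HOL-Library.Poly_Mapping"
    "HOL-Library.Extended_Nat"
    "Berlekamp_Zassenhaus.Finite_Field"
begin

section \<open>The ring of \<open>p\<close>-adic integers\<close>

text \<open>
  The prime is \<open>p = CARD('p)\<close>, so that the residue field is the type \<open>'p mod_ring\<close>.
  An element is a coherent sequence of residues \<open>x n \<in> {0..<p ^ n}\<close>;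
  the stated condition already forces \<open>x n\<close> into this range.
\<close>

typedef (overloaded) ('p :: prime_card) padic_int =
  "{x :: nat \<Rightarrow> int. \<forall>n. x (Suc n) mod int CARD('p) ^ n = x n}"
  by (rule exI[of _ "\<lambda>_. 0"]) simp

setup_lifting type_definition_padic_int

lemma mod_Suc_power_cancel:
  "(a :: int) mod q ^ Suc n mod q ^ n = a mod q ^ n"
  by (rule mod_mod_cancel) simp

lemma coherent_mod:
  "\<forall>n. x (Suc n) mod q ^ n = x n \<Longrightarrow> x n mod q ^ n = (x n :: int)"
  by (metis mod_mod_trivial)

instantiation padic_int :: (prime_card) comm_ring_1
begin

lift_definition zero_padic_int :: "'a padic_int" is "\<lambda>_. 0" by simp

lift_definition one_padic_int :: "'a padic_int" is "\<lambda>n. 1 mod int CARD('a) ^ n"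
  by (simp only: mod_Suc_power_cancel simp_thms)

lift_definition plus_padic_int :: "'a padic_int \<Rightarrow> 'a padic_int \<Rightarrow> 'a padic_int"
  is "\<lambda>x y n. (x n + y n) mod int CARD('a) ^ n"
  by (simp only: mod_Suc_power_cancel) (metis mod_add_eq)

lift_definition uminus_padic_int :: "'a padic_int \<Rightarrow> 'a padic_int"
  is "\<lambda>x n. (- x n) mod int CARD('a) ^ n"
  by (simp only: mod_Suc_power_cancel) (metis mod_minus_eq)

lift_definition minus_padic_int :: "'a padic_int \<Rightarrow> 'a padic_int \<Rightarrow> 'a padic_int"
  is "\<lambda>x y n. (x n - y n) mod int CARD('a) ^ n"
  by (simp only: mod_Suc_power_cancel) (metis mod_diff_eq)

lift_definition times_padic_int :: "'a padic_int \<Rightarrow> 'a padic_int \<Rightarrow> 'a padic_int"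
  is "\<lambda>x y n. (x n * y n) mod int CARD('a) ^ n"
  by (simp only: mod_Suc_power_cancel) (metis mod_mult_eq)

instance
proof
  fix a b c :: "'a padic_int"
  show "a * b * c = a * (b * c)"
    by transfer (simp add: fun_eq_iff mod_simps mult.assoc)
  show "a * b = b * a"
    by transfer (simp add: mult.commute)
  show "1 * a = a"
    by transfer (simp add: fun_eq_iff mod_simps coherent_mod)
  show "a + b + c = a + (b + c)"
    by transfer (simp add: fun_eq_iff mod_simps add.assoc)
  show "a + b = b + a"
    by transfer (simp add: add.commute)
  show "0 + a = a"
    by transfer (simp add: fun_eq_iff coherent_mod)
  show "- a + a = 0"
    by transfer (simp add: fun_eq_iff mod_simps)
  show "a - b = a + - b"
    by transfer (simp add: fun_eq_iff mod_simps)
  show "(a + b) * c = a * c + b * c"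
    by transfer (simp add: fun_eq_iff mod_simps distrib_right)
  show "(0 :: 'a padic_int) \<noteq> 1"
  proof transfer
    have "(1 :: int) mod int CARD('a) ^ 1 = 1"
      using prime_card[where ?'a = 'a] by (simp add: prime_gt_1_nat)
    then show "(\<lambda>_. 0) \<noteq> (\<lambda>n. 1 mod int CARD('a) ^ n)"
      by (metis zero_neq_one)
  qed
qed

end

lemma Rep_padic_int_mod_le:
  fixes x :: "'p :: prime_card padic_int"
  assumes "m \<le> n"
  shows "Rep_padic_int x n mod int CARD('p) ^ m = Rep_padic_int x m"
  using assms
proof (induction n rule: dec_induct)
  case base
  have "Rep_padic_int x (Suc m) mod int CARD('p) ^ m = Rep_padic_int x m"
    using Rep_padic_int[of x] by simp
  then show ?case by (metis mod_mod_trivial)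
next
  case (step n)
  have "Rep_padic_int x (Suc n) mod int CARD('p) ^ n = Rep_padic_int x n"
    using Rep_padic_int[of x] by simp
  moreover have "int CARD('p) ^ m dvd int CARD('p) ^ n"
    using step by (simp add: le_imp_power_dvd)
  ultimately show ?case
    using step by (metis mod_mod_cancel)
qed

lemma Rep_padic_int_of_nat:
  "Rep_padic_int (of_nat k :: 'p :: prime_card padic_int) n = int k mod int CARD('p) ^ n"
  by (induction k)
     (simp_all add: zero_padic_int.rep_eq plus_padic_int.rep_eq one_padic_int.rep_eq mod_simps)

instance padic_int :: (prime_card) idom
proof
  fix a b :: "'a padic_int"
  let ?p = "int CARD('a)"
  assume "a \<noteq> 0" "b \<noteq> 0"
  then obtain m n where m: "Rep_padic_int a m \<noteq> 0" and n: "Rep_padic_int b n \<noteq> 0"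
    by (metis Rep_padic_int_inject ext zero_padic_int.rep_eq)
  have p: "prime ?p"
    using prime_card[where ?'a = 'a] by simp
  define x y where "x = Rep_padic_int a (m + n)" and "y = Rep_padic_int b (m + n)"
  have x: "\<not> ?p ^ m dvd x"
    using m Rep_padic_int_mod_le[of m "m + n" a] by (auto simp: x_def)
  have y: "\<not> ?p ^ n dvd y"
    using n Rep_padic_int_mod_le[of n "m + n" b] by (auto simp: y_def)
  have "x \<noteq> 0" "y \<noteq> 0"
    using x y by auto
  have "multiplicity ?p x < m" "multiplicity ?p y < n"
    using x y p \<open>x \<noteq> 0\<close> \<open>y \<noteq> 0\<close> by (meson multiplicity_dvd' not_le)+
  then have "multiplicity ?p (x * y) < m + n"
    using p \<open>x \<noteq> 0\<close> \<open>y \<noteq> 0\<close> by (simp add: prime_elem_multiplicity_mult_distrib)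
  then have "\<not> ?p ^ (m + n) dvd x * y"
    using p \<open>x \<noteq> 0\<close> \<open>y \<noteq> 0\<close>
    by (metis mult_eq_0_iff multiplicity_geI not_le not_prime_unit)
  then have "Rep_padic_int (a * b) (m + n) \<noteq> 0"
    by (simp add: times_padic_int.rep_eq x_def y_def dvd_eq_mod_eq_0)
  then show "a * b \<noteq> 0"
    by (auto simp: zero_padic_int.rep_eq)
qed

instance padic_int :: (prime_card) ring_char_0
proof
  show "inj (of_nat :: nat \<Rightarrow> 'a padic_int)"
  proof (rule injI)
    fix k l :: nat
    assume "(of_nat k :: 'a padic_int) = of_nat l"
    then have eq: "int k mod int CARD('a) ^ n = int l mod int CARD('a) ^ n" for n
      by (metis Rep_padic_int_of_nat)
    have "1 < CARD('a)"
      by (rule prime_gt_1_nat[OF prime_card])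
    then have "max k l < CARD('a) ^ max k l"
      by (intro power_gt_expt) simp
    then have "int k < int CARD('a) ^ max k l" "int l < int CARD('a) ^ max k l"
      by (metis max.strict_boundedE of_nat_less_iff of_nat_power)+
    then show "k = l"
      using eq[of "max k l"] by simp
  qed
qed

instantiation padic_int :: (prime_card) idom_divide
begin

definition divide_padic_int :: "'a padic_int \<Rightarrow> 'a padic_int \<Rightarrow> 'a padic_int"
  where "divide_padic_int x y = (if y = 0 then 0 else THE z. z * y = x)"

instance
proof
  fix a b :: "'a padic_int"
  show "b \<noteq> 0 \<Longrightarrow> a * b div b = a"
    by (simp add: divide_padic_int_def)
  show "a div 0 = 0"
    by (simp add: divide_padic_int_def)
qed

end

definition padic_reduce :: "'p :: prime_card padic_int \<Rightarrow> 'p mod_ring"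
  where "padic_reduce x = of_int (Rep_padic_int x 1)"

definition padic_val :: "'p :: prime_card padic_int \<Rightarrow> enat"
  where "padic_val x =
    (if x = 0 then \<infinity> else enat (Max {n. of_nat CARD('p) ^ n dvd x}))"


section \<open>Algebras, traces and \<open>p\<close>-adic limits\<close>

text \<open>
  An \<open>R\<close>-algebra is a commutative ring \<open>'a\<close> with a structure homomorphism \<open>\<phi> : R \<rightarrow> A\<close>.
\<close>

definition alg_scale :: "('r :: comm_ring_1 \<Rightarrow> 'a :: comm_ring_1) \<Rightarrow> 'r \<Rightarrow> 'a \<Rightarrow> 'a"
  where "alg_scale \<phi> r x = \<phi> r * x"

lemma module_alg_scale: "comm_ring_hom \<phi> \<Longrightarrow> Modules.module (alg_scale \<phi>)"
proof -
  assume "comm_ring_hom \<phi>"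
  then interpret comm_ring_hom \<phi> .
  show ?thesis
    by unfold_locales (simp_all add: alg_scale_def algebra_simps hom_add hom_mult)
qed

definition alg_basis :: "('r :: comm_ring_1 \<Rightarrow> 'a :: comm_ring_1) \<Rightarrow> 'a set \<Rightarrow> bool"
  where "alg_basis \<phi> B \<longleftrightarrow>
    \<not> Modules.module.dependent (alg_scale \<phi>) B \<and> Modules.module.span (alg_scale \<phi>) B = UNIV"

lemma module_free_scale:
  "Modules.module (\<lambda>c :: 'a :: comm_ring_1. Poly_Mapping.map ((*) c) :: ('b \<Rightarrow>\<^sub>0 'a) \<Rightarrow> _)"
proof -
  have "Poly_Mapping.lookup (Poly_Mapping.map ((*) c) f) k = c * Poly_Mapping.lookup f k"
    for c :: 'a and f :: "'b \<Rightarrow>\<^sub>0 'a" and k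
    by (simp add: Poly_Mapping.map.rep_eq when_def)
  then show ?thesis
    by unfold_locales (auto intro!: poly_mapping_eqI simp: lookup_add algebra_simps)
qed

text \<open>
  The module of Kaehler differentials is the free \<open>A\<close>-module on symbols \<open>dx\<close> for \<open>x \<in> A\<close>,
  here the finitely supported functions \<open>'a \<Rightarrow>\<^sub>0 'a\<close> with \<open>a dx = single x a\<close>,
  modulo the submodule spanned by additivity, the Leibniz rule and \<open>dr = 0\<close> for \<open>r \<in> R\<close>.
\<close>

definition kaehler_relations ::
    "('r :: comm_ring_1 \<Rightarrow> 'a :: comm_ring_1) \<Rightarrow> ('a \<Rightarrow>\<^sub>0 'a) set"
  where "kaehler_relations \<phi> =
    {Poly_Mapping.single (x + y) 1 - Poly_Mapping.single x 1 - Poly_Mapping.single y 1 | x y. True}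
    \<union> {Poly_Mapping.single (x * y) 1 - Poly_Mapping.single y x - Poly_Mapping.single x y | x y. True}
    \<union> {Poly_Mapping.single (\<phi> r) 1 | r. True}"

definition kaehler_differentials_vanish ::
    "('r :: comm_ring_1 \<Rightarrow> 'a :: comm_ring_1) \<Rightarrow> bool"
  where "kaehler_differentials_vanish \<phi> \<longleftrightarrow>
    Modules.module.span (\<lambda>c. Poly_Mapping.map ((*) c)) (kaehler_relations \<phi>) = UNIV"

text \<open>
  Finite etale means finite, flat and unramified. The base is used here only when it is a
  local ring, so that finite flat of rank \<open>d\<close> means free of rank \<open>d\<close>.
\<close>

definition finite_etale_of_rank ::
    "('r :: comm_ring_1 \<Rightarrow> 'a :: comm_ring_1) \<Rightarrow> nat \<Rightarrow> bool"
  where "finite_etale_of_rank \<phi> d \<longleftrightarrow>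
    comm_ring_hom \<phi> \<and>
    (\<exists>B. finite B \<and> card B = d \<and> alg_basis \<phi> B) \<and>
    kaehler_differentials_vanish \<phi>"

text \<open>The trace of multiplication by \<open>y\<close>; it does not depend on the chosen basis.\<close>

definition alg_trace :: "('r :: comm_ring_1 \<Rightarrow> 'a :: comm_ring_1) \<Rightarrow> 'a \<Rightarrow> 'r"
  where "alg_trace \<phi> y =
    (let B = (SOME B. finite B \<and> alg_basis \<phi> B)
     in \<Sum>b\<in>B. Modules.module.representation (alg_scale \<phi>) B (y * b) b)"

definition unit_power_int :: "'a :: comm_ring_1 \<Rightarrow> int \<Rightarrow> 'a"
  where "unit_power_int x k =
    (if 0 \<le> k then x ^ nat k else (THE y. x * y = 1) ^ nat (- k))"

definition residue_class :: "nat \<Rightarrow> 'a :: comm_ring_1 \<Rightarrow> 'a set"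
  where "residue_class p x = {y. of_nat p dvd y - x}"

definition residue_order :: "nat \<Rightarrow> 'a :: comm_ring_1 \<Rightarrow> nat"
  where "residue_order p x = (LEAST n. 0 < n \<and> residue_class p (x ^ n) = residue_class p 1)"

text \<open>
  The classes of \<open>v 0, \<dots>, v (d - 1)\<close> form a basis of \<open>A/pA\<close> over the field with \<open>p\<close> elements,
  whose elements act through their integer representatives.
\<close>

definition residue_basis :: "'p :: prime_card itself \<Rightarrow> nat \<Rightarrow> (nat \<Rightarrow> 'a :: comm_ring_1) \<Rightarrow> bool"
  where "residue_basis T d v \<longleftrightarrow>
    (\<forall>x. \<exists>c :: nat \<Rightarrow> 'p mod_ring.
        residue_class CARD('p) x =
        residue_class CARD('p) (\<Sum>i<d. of_int (to_int_mod_ring (c i)) * v i)) \<and>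
    (\<forall>c :: nat \<Rightarrow> 'p mod_ring.
        residue_class CARD('p) (\<Sum>i<d. of_int (to_int_mod_ring (c i)) * v i) =
        residue_class CARD('p) 0 \<longrightarrow> (\<forall>i<d. c i = 0))"

text \<open>Convergence of series in the \<open>p\<close>-adic topology of a commutative ring.\<close>

definition padic_sums :: "nat \<Rightarrow> (nat \<Rightarrow> 'a :: comm_ring_1) \<Rightarrow> 'a \<Rightarrow> bool"
  where "padic_sums p f s \<longleftrightarrow>
    (\<forall>k. \<exists>N. \<forall>n\<ge>N. of_nat p ^ k dvd (\<Sum>m<n. f m) - s)"

definition padic_suminf :: "nat \<Rightarrow> (nat \<Rightarrow> 'a :: comm_ring_1) \<Rightarrow> 'a"
  where "padic_suminf p f = (THE s. padic_sums p f s)"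

text \<open>The quotient is exact, by continuity from the case of natural \<open>t\<close>.\<close>

definition padic_binomial :: "'p :: prime_card padic_int \<Rightarrow> nat \<Rightarrow> 'p padic_int"
  where "padic_binomial t m = (\<Prod>i<m. t - of_nat i) div fact m"

definition binomial_power ::
    "('p :: prime_card padic_int \<Rightarrow> 'a :: comm_ring_1) \<Rightarrow> 'a \<Rightarrow> 'p padic_int \<Rightarrow> 'a"
  where "binomial_power \<phi> z t = padic_suminf CARD('p) (\<lambda>m. \<phi> (padic_binomial t m) * (z - 1) ^ m)"


section \<open>Restricted power series\<close>

definition restricted_series :: "'p :: prime_card padic_int fps set"
  where "restricted_series =
    {f. \<forall>k. \<exists>N. \<forall>n\<ge>N. of_nat CARD('p) ^ k dvd fps_nth f n}"

definition restricted_units :: "'p :: prime_card padic_int fps set"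
  where "restricted_units =
    {f \<in> restricted_series. \<exists>g\<in>restricted_series. f * g = 1}"

definition restricted_eval :: "'p :: prime_card padic_int fps \<Rightarrow> 'p padic_int \<Rightarrow> 'p padic_int"
  where "restricted_eval f t = padic_suminf CARD('p) (\<lambda>n. fps_nth f n * t ^ n)"

definition series_reduce :: "'p :: prime_card padic_int fps \<Rightarrow> 'p mod_ring fps"
  where "series_reduce f = Abs_fps (\<lambda>n. padic_reduce (fps_nth f n))"

text \<open>
  Distinguished in the sense of Weierstrass preparation for restricted power series: monic,
  with no condition on the lower coefficients (unlike over \<open>\<int>\<^sub>p[[X]]\<close>, where they are
  divisible by \<open>p\<close>).
\<close>

definition distinguished_poly :: "'p :: prime_card padic_int poly \<Rightarrow> nat \<Rightarrow> bool"
  where "distinguished_poly W e \<longleftrightarrow> lead_coeff W = 1 \<and> Polynomial.degree W = e"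

definition weierstrass_factorization ::
    "'p :: prime_card padic_int fps \<Rightarrow> nat \<Rightarrow> nat \<Rightarrow>
     'p padic_int poly \<Rightarrow> 'p padic_int fps \<Rightarrow> bool"
  where "weierstrass_factorization f s e W V \<longleftrightarrow>
    distinguished_poly W e \<and> V \<in> restricted_units \<and>
    f = fps_const (of_nat CARD('p) ^ s) * fps_of_poly W * V"

text \<open>The polynomial \<open>X (X - 1) \<cdots> (X - m + 1) / m!\<close>, meaningful for \<open>m < p\<close>.\<close>

definition binomial_poly :: "nat \<Rightarrow> 'p :: prime_card mod_ring poly"
  where "binomial_poly m = Polynomial.smult (inverse (of_nat (fact m))) (\<Prod>i<m. [:- of_nat i, 1:])"


section \<open>The trace function and its leading part\<close>

definition trace_coeff ::
    "('p :: prime_card padic_int \<Rightarrow> 'a :: comm_ring_1) \<Rightarrow> 'a \<Rightarrow> 'a \<Rightarrow> nat \<Rightarrow> 'p padic_int"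
  where "trace_coeff \<phi> y U m = alg_trace \<phi> (y * U ^ m)"

definition trace_fun ::
    "('p :: prime_card padic_int \<Rightarrow> 'a :: comm_ring_1) \<Rightarrow> 'a \<Rightarrow> 'a \<Rightarrow> 'p padic_int \<Rightarrow> 'p padic_int"
  where "trace_fun \<phi> y z t = alg_trace \<phi> (y * binomial_power \<phi> z t)"

definition min_slope :: "nat \<Rightarrow> (nat \<Rightarrow> 'p :: prime_card padic_int) \<Rightarrow> enat"
  where "min_slope d C = Min ((\<lambda>m. enat m + padic_val (C m)) ` {..<d})"

definition leading_poly ::
    "nat \<Rightarrow> nat \<Rightarrow> (nat \<Rightarrow> 'p :: prime_card padic_int) \<Rightarrow> 'p mod_ring poly"
  where "leading_poly d s C =
    (\<Sum>m \<in> {m. m < d \<and> enat m + padic_val (C m) = enat s}.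
       Polynomial.smult (padic_reduce (C m div of_nat CARD('p) ^ (s - m))) (binomial_poly m))"

end

theory Submission
  imports Defs
begin

text \<open>
  By successive approximation the powers \<open>1, U, \<dots>, U ^ (d - 1)\<close> form a \<open>\<int>\<^sub>p\<close>-basis of the algebra.
  Let \<open>f\<close> be the monic polynomial of degree \<open>d\<close> with root \<open>U\<close>. Euler's formula expresses the trace
  as \<open>Tr x = \<lambda> (f'(U) x)\<close>, where \<open>\<lambda>\<close> is the coefficient of \<open>U ^ (d - 1)\<close>, and the vanishing of the
  differentials makes \<open>f'(U)\<close> a unit. Hence the trace form is nondegenerate modulo \<open>p\<close> and some
  \<open>C m\<close> with \<open>m < d\<close> is a unit, which bounds the slope by \<open>d - 1\<close>.

  By continuity of the trace, \<open>F t\<close> is the sum of \<open>(p ^ m C m / m!) t (t - 1) \<cdots> (t - m + 1)\<close>. Since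
  \<open>d < p\<close>, Legendre's bound on the valuation of \<open>m!\<close> shows that the terms with \<open>m \<ge> d\<close> vanish
  modulo \<open>p ^ (s + 1)\<close>, so only the terms of slope \<open>s\<close> survive in the reduction of \<open>F / p ^ s\<close>.
  Weierstrass division gives the factorization, and applied to the rescaled polynomial
  \<open>W (c + p X) / p\<close> it also gives the simple roots.
\<close>

text \<open>Analysis is replaced by congruences: a restricted series agrees with some polynomial
  modulo every \<open>p ^ k\<close>, and its values are those of the polynomials to the same
  precision. The series for \<open>F\<close> is expanded in falling factorials, with coefficients
  c_m = p^m C_m / (m! p^s), because these coefficients are explicit and the falling factorials are
  monic of distinct degrees: they stay independent modulo p, and a single c_m prime to p with m < d
  keeps the reduction from vanishing. The inequality d < p enters twice. For m < d it makes m! a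
  unit, so the valuation of c_m is exactly m + v(C_m) - s. For m \<ge> d it gives v(m!) \<le> m - d,
  and since s \<le> d - 1 one factor p is left over in c_m. This is why the bound on the slope must
  come before the study of the series. For p = 2, where d = 1, there is a further obstacle: with U =
  -1 the function F is a multiple of (-1)^t, which no restricted series represents. Hence the
  condition that U be even in that case.\<close>

abbreviation \<pp> :: "'p :: prime_card padic_int"
  where "\<pp> \<equiv> of_nat CARD('p)"

section \<open>Arithmetic of the \<open>p\<close>-adic integers\<close>

lemma Rep_padic_int_mod [simp]:
  "Rep_padic_int (x :: 'p :: prime_card padic_int) n mod int CARD('p) ^ n = Rep_padic_int x n"
  by (rule Rep_padic_int_mod_le) simp

lemma Rep_padic_int_nonneg: "0 \<le> Rep_padic_int (x :: 'p :: prime_card padic_int) n"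
proof -
  have "0 < int CARD('p)" using prime_card[where ?'a = 'p] by (simp add: prime_gt_0_nat)
  then show ?thesis by (metis Rep_padic_int_mod pos_mod_sign zero_less_power)
qed

lemma padic_power_dvd_iff:
  fixes x :: "'p :: prime_card padic_int"
  shows "\<pp> ^ k dvd x \<longleftrightarrow> Rep_padic_int x k = 0"
proof
  assume "\<pp> ^ k dvd x"
  then obtain z where x: "x = of_nat (CARD('p) ^ k) * z" by (auto simp: dvd_def)
  show "Rep_padic_int x k = 0"
    unfolding x times_padic_int.rep_eq Rep_padic_int_of_nat by simp
next
  let ?q = "int CARD('p)"
  assume 0: "Rep_padic_int x k = 0"
  have q: "0 < ?q" using prime_card[where ?'a = 'p] by (simp add: prime_gt_0_nat)
  \<comment> \<open>Dividing by \<open>p ^ k\<close> costs k digits of precision, so the n-th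
    residue of the quotient is read off from residue n + k of \<open>x\<close>.\<close>
  define z where "z = (\<lambda>n. Rep_padic_int x (n + k) div ?q ^ k)"
  have coh: "z (Suc n) mod ?q ^ n = z n" for n
  proof -
    let ?a = "Rep_padic_int x (Suc n + k)"
    have "Rep_padic_int x (n + k) = ?a mod (?q ^ k * ?q ^ n)"
      using Rep_padic_int_mod_le[of "n + k" "Suc n + k" x] by (simp add: power_add mult.commute)
    also have "\<dots> = ?q ^ k * (?a div ?q ^ k mod ?q ^ n) + ?a mod ?q ^ k"
      by (rule zmod_zmult2_eq) (use q in simp)
    finally show ?thesis using q by (simp add: z_def)
  qed
  have "x = of_nat (CARD('p) ^ k) * Abs_padic_int z"
  proof (rule Rep_padic_int_inject[THEN iffD1, OF ext])
    fix n
    have "Rep_padic_int x (n + k) mod ?q ^ k = 0"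
      using Rep_padic_int_mod_le[of k "n + k" x] 0 by simp
    then have *: "?q ^ k * z n = Rep_padic_int x (n + k)" by (auto simp: z_def)
    have "Rep_padic_int (of_nat (CARD('p) ^ k) * Abs_padic_int z :: 'p padic_int) n
        = (?q ^ k mod ?q ^ n * z n) mod ?q ^ n"
      using coh by (simp add: times_padic_int.rep_eq Rep_padic_int_of_nat Abs_padic_int_inverse del: of_nat_power)
        (simp add: mod_simps)
    also have "\<dots> = Rep_padic_int x n"
      using * Rep_padic_int_mod_le[of n "n + k" x] by (simp add: mod_simps)
    finally show "Rep_padic_int x n = Rep_padic_int (of_nat (CARD('p) ^ k) * Abs_padic_int z :: 'p padic_int) n" ..
  qed
  then show "\<pp> ^ k dvd x" by (metis dvd_triv_left of_nat_power)
qed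

lemma padic_separated:
  fixes x :: "'p :: prime_card padic_int"
  assumes "\<And>k. \<pp> ^ k dvd x"
  shows "x = 0"
  using assms by (intro Rep_padic_int_inject[THEN iffD1]) (auto simp: padic_power_dvd_iff zero_padic_int.rep_eq)

lemma padic_power_dvd_diff_iff:
  fixes x y :: "'p :: prime_card padic_int"
  shows "\<pp> ^ k dvd x - y \<longleftrightarrow> Rep_padic_int x k = Rep_padic_int y k"
  unfolding padic_power_dvd_iff minus_padic_int.rep_eq
  by (metis Rep_padic_int_mod mod_eq_dvd_iff dvd_eq_mod_eq_0)

lemma Rep_padic_int_of_int:
  "Rep_padic_int (of_int j :: 'p :: prime_card padic_int) n = j mod int CARD('p) ^ n"
proof (cases "0 \<le> j")
  case True
  then obtain k where "j = int k" by (metis nonneg_int_cases)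
  then show ?thesis by (simp add: Rep_padic_int_of_nat)
next
  case False
  then obtain k where "j = - int k" by (metis int_cases4 of_nat_0_le_iff)
  then show ?thesis by (simp add: Rep_padic_int_of_nat uminus_padic_int.rep_eq mod_minus_eq)
qed

lemma padic_approx_of_nat:
  fixes x :: "'p :: prime_card padic_int"
  obtains n :: nat where "\<pp> ^ k dvd x - of_nat n"
proof -
  have "\<pp> ^ k dvd x - of_nat (nat (Rep_padic_int x k))"
    unfolding padic_power_dvd_diff_iff Rep_padic_int_of_nat
    by (simp add: Rep_padic_int_nonneg)
  then show ?thesis by (rule that)
qed

lemma padic_Cauchy_limit:
  fixes S :: "nat \<Rightarrow> 'p :: prime_card padic_int"
  assumes "\<And>k. \<exists>N. \<forall>n\<ge>N. \<pp> ^ k dvd S n - S N"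
  obtains s where "\<And>k. \<exists>N. \<forall>n\<ge>N. \<pp> ^ k dvd S n - s"
proof -
  let ?q = "int CARD('p)"
  have "\<forall>k. \<exists>N. \<forall>n\<ge>N. Rep_padic_int (S n) k = Rep_padic_int (S N) k"
    using assms unfolding padic_power_dvd_diff_iff by simp
  from choice[OF this] obtain N
    where N: "\<forall>k. \<forall>n\<ge>N k. Rep_padic_int (S n) k = Rep_padic_int (S (N k)) k" ..
  define s where "s = (\<lambda>k. Rep_padic_int (S (N k)) k)"
  have "s (Suc k) mod ?q ^ k = s k" for k
  proof -
    let ?n = "max (N k) (N (Suc k))"
    have "s (Suc k) = Rep_padic_int (S ?n) (Suc k)" "s k = Rep_padic_int (S ?n) k"
      unfolding s_def using N by (metis max.cobounded1 max.cobounded2)+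
    then show ?thesis using Rep_padic_int_mod_le[of k "Suc k" "S ?n"] by simp
  qed
  then have rep: "Rep_padic_int (Abs_padic_int s :: 'p padic_int) = s" by (simp add: Abs_padic_int_inverse)
  show ?thesis
  proof (rule that[of "Abs_padic_int s"])
    fix k show "\<exists>N. \<forall>n\<ge>N. \<pp> ^ k dvd S n - Abs_padic_int s"
      unfolding padic_power_dvd_diff_iff rep unfolding s_def
      by (intro exI[of _ "N k"]) (rule N[THEN spec])
  qed
qed

text \<open>Besides existence this records the rate: the K-th partial sum is correct modulo
  \<open>p ^ K\<close>. The successive approximations below apply it coordinate by
  coordinate.\<close>

lemma padic_power_series_limit:
  fixes a :: "nat \<Rightarrow> 'p :: prime_card padic_int"
  obtains s where "\<And>K. \<pp> ^ K dvd s - (\<Sum>k<K. \<pp> ^ k * a k)"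
proof -
  define S where "S = (\<lambda>K. \<Sum>k<K. \<pp> ^ k * a k)"
  have S: "\<pp> ^ K dvd S n - S K" if "n \<ge> K" for n K
  proof -
    have "S n - S K = (\<Sum>k\<in>{K..<n}. \<pp> ^ k * a k)"
      unfolding S_def using sum_diff_nat_ivl[of 0 K n "\<lambda>k. \<pp> ^ k * a k"] that
      by (simp add: lessThan_atLeast0)
    also have "\<pp> ^ K dvd \<dots>"
      by (intro dvd_sum dvd_mult2 le_imp_power_dvd) auto
    finally show ?thesis .
  qed
  obtain s where s: "\<And>k. \<exists>N. \<forall>n\<ge>N. \<pp> ^ k dvd S n - s"
    using padic_Cauchy_limit[of S] S by blast
  have "\<pp> ^ K dvd s - S K" for K
  proof -
    obtain n where n: "n \<ge> K" "\<pp> ^ K dvd S n - s" using s[of K] by (metis nat_le_linear)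
    have "s - S K = (S n - S K) - (S n - s)" by simp
    then show ?thesis using S[OF n(1)] n(2) by (metis dvd_diff)
  qed
  then show ?thesis using that unfolding S_def by blast
qed

lemma padic_sums_summable:
  fixes f :: "nat \<Rightarrow> 'p :: prime_card padic_int"
  assumes "\<And>k. \<exists>N. \<forall>n\<ge>N. \<pp> ^ k dvd f n"
  obtains s where "padic_sums CARD('p) f s"
proof -
  have "\<exists>N. \<forall>n\<ge>N. \<pp> ^ k dvd (\<Sum>m<n. f m) - (\<Sum>m<N. f m)" for k
  proof -
    obtain N where N: "\<And>n. n \<ge> N \<Longrightarrow> \<pp> ^ k dvd f n" using assms by blast
    have "\<pp> ^ k dvd (\<Sum>m<n. f m) - (\<Sum>m<N. f m)" if "n \<ge> N" for n
    proof -
      have "(\<Sum>m<n. f m) - (\<Sum>m<N. f m) = (\<Sum>m\<in>{N..<n}. f m)"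
        using sum_diff_nat_ivl[of 0 N n f] that by (simp add: lessThan_atLeast0)
      also have "\<pp> ^ k dvd \<dots>" by (intro dvd_sum N) auto
      finally show ?thesis .
    qed
    then show ?thesis by blast
  qed
  then obtain s where "\<And>k. \<exists>N. \<forall>n\<ge>N. \<pp> ^ k dvd (\<Sum>m<n. f m) - s"
    using padic_Cauchy_limit[of "\<lambda>n. \<Sum>m<n. f m"] by blast
  then show ?thesis using that by (auto simp: padic_sums_def)
qed

text \<open>Separatedness is what makes the \<open>THE\<close> in \<open>padic_suminf\<close>
  meaningful. It is a hypothesis because the lemma serves both the p-adic integers and the finite
  free algebra.\<close>

lemma padic_suminf_eqI:
  fixes s :: "'a :: comm_ring_1"
  assumes sep: "\<And>x :: 'a. (\<And>k. of_nat p ^ k dvd x) \<Longrightarrow> x = 0"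
    and s: "padic_sums p f s"
  shows "padic_suminf p f = s"
  unfolding padic_suminf_def
proof (rule the_equality)
  show "padic_sums p f s" by (rule s)
next
  fix s' assume s': "padic_sums p f s'"
  have "of_nat p ^ k dvd s' - s" for k
  proof -
    obtain N N' where "\<And>n. n \<ge> N \<Longrightarrow> of_nat p ^ k dvd (\<Sum>m<n. f m) - s"
      "\<And>n. n \<ge> N' \<Longrightarrow> of_nat p ^ k dvd (\<Sum>m<n. f m) - s'"
      using s s' unfolding padic_sums_def by metis
    then have "of_nat p ^ k dvd ((\<Sum>m<max N N'. f m) - s) - ((\<Sum>m<max N N'. f m) - s')"
      by (meson dvd_diff max.cobounded1 max.cobounded2)
    then show ?thesis by simp
  qed
  then show "s' = s" using sep[of "s' - s"] by simp
qed

lemma padic_reduce_of_int [simp]: "padic_reduce (of_int j :: 'p :: prime_card padic_int) = of_int j"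
proof -
  have "(of_int (j mod int CARD('p)) :: 'p mod_ring) = of_int j"
    by (metis of_int_of_int_mod_ring of_int_mod_ring.abs_eq mod_mod_trivial of_int_mod_ring.rep_eq Rep_mod_ring_inject)
  then show ?thesis by (simp add: padic_reduce_def Rep_padic_int_of_int)
qed

lemma padic_reduce_eq_0_iff: "padic_reduce (x :: 'p :: prime_card padic_int) = 0 \<longleftrightarrow> \<pp> dvd x"
proof -
  have "0 \<le> Rep_padic_int x 1" "Rep_padic_int x 1 < int CARD('p)"
    using Rep_padic_int_mod[of x 1] Rep_padic_int_nonneg[of x 1] 
     pos_mod_bound[of "int CARD('p)" "Rep_padic_int x 1"] prime_card[where ?'a = 'p] by (auto simp: prime_gt_0_nat)
  then have "to_int_mod_ring (padic_reduce x) = Rep_padic_int x 1"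
    by (simp add: padic_reduce_def of_int_of_int_mod_ring)
  then show ?thesis using padic_power_dvd_iff[of 1 x]
    by (metis power_one_right to_int_mod_ring_hom.hom_0_iff)
qed

lemma padic_reduce_cong:
  fixes x y :: "'p :: prime_card padic_int"
  assumes "\<pp> dvd x - y"
  shows "padic_reduce x = padic_reduce y"
  using assms padic_power_dvd_diff_iff[of 1 x y] by (simp add: padic_reduce_def)

interpretation padic_reduce: comm_ring_hom "padic_reduce :: 'p :: prime_card padic_int \<Rightarrow> 'p mod_ring"
proof
  fix x y :: "'p padic_int"
  obtain m n where m: "\<pp> dvd x - of_nat m" and n: "\<pp> dvd y - of_nat n"
    using padic_approx_of_nat[of 1] by (metis power_one_right)
  have red: "padic_reduce x = of_nat m" "padic_reduce y = of_nat n"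
    using padic_reduce_cong[OF m] padic_reduce_cong[OF n] padic_reduce_of_int[of "int m"]
      padic_reduce_of_int[of "int n"] by simp_all
  have "x + y - of_int (int (m + n)) = (x - of_nat m) + (y - of_nat n)" by simp
  then have "\<pp> dvd x + y - of_int (int (m + n))" using m n by (metis dvd_add)
  then show "padic_reduce (x + y) = padic_reduce x + padic_reduce y"
    using padic_reduce_cong red by (metis padic_reduce_of_int of_int_of_nat_eq of_nat_add)
  have "x * y - of_int (int (m * n)) = (x - of_nat m) * y + of_nat m * (y - of_nat n)"
    by (simp add: algebra_simps)
  then have "\<pp> dvd x * y - of_int (int (m * n))" using m n by (metis dvd_add dvd_mult dvd_mult2)
  then show "padic_reduce (x * y) = padic_reduce x * padic_reduce y"
    using padic_reduce_cong red by (metis padic_reduce_of_int of_int_of_nat_eq of_nat_mult)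
  show "padic_reduce (1 :: 'p padic_int) = 1" using padic_reduce_of_int[of 1] by simp
  show "padic_reduce (0 :: 'p padic_int) = 0" using padic_reduce_of_int[of 0] by simp
qed

lemma padic_reduce_eq_iff:
  "padic_reduce x = padic_reduce y \<longleftrightarrow> \<pp> dvd (x :: 'p :: prime_card padic_int) - y"
  by (metis padic_reduce.hom_minus padic_reduce_eq_0_iff eq_iff_diff_eq_0)

lemma surj_padic_reduce: "\<exists>x :: 'p :: prime_card padic_int. padic_reduce x = r"
  by (metis of_int_of_int_mod_ring of_int_mod_ring_to_int_mod_ring padic_reduce_of_int)

text \<open>A lift v of the inverse modulo p gives x v = 1 - p w, which the geometric series in p w
  inverts.\<close>

lemma padic_unit_iff: "(x :: 'p :: prime_card padic_int) dvd 1 \<longleftrightarrow> \<not> \<pp> dvd x"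
proof
  assume "x dvd 1"
  then show "\<not> \<pp> dvd x"
    by (metis dvd_trans padic_reduce_eq_0_iff padic_reduce.hom_one zero_neq_one)
next
  assume "\<not> \<pp> dvd x"
  then have nz: "padic_reduce x \<noteq> 0" by (simp add: padic_reduce_eq_0_iff)
  obtain v where "padic_reduce v = inverse (padic_reduce x)" using surj_padic_reduce by blast
  then have "padic_reduce (1 - x * v) = 0" using nz by (simp add: padic_reduce.hom_minus padic_reduce.hom_mult)
  then obtain w where w: "1 - x * v = \<pp> * w" unfolding padic_reduce_eq_0_iff by (auto simp: dvd_def)
  obtain s where s: "\<And>K. \<pp> ^ K dvd s - (\<Sum>k<K. \<pp> ^ k * w ^ k)"
    using padic_power_series_limit[of "\<lambda>k. w ^ k"] by blast
  have "\<pp> ^ K dvd x * v * s - 1" for K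
  proof -
    have "x * v = 1 - \<pp> * w" using w by (simp add: algebra_simps)
    moreover define T where "T = (\<Sum>k<K. \<pp> ^ k * w ^ k)"
    moreover have "(1 - \<pp> * w) * (\<Sum>k<K. \<pp> ^ k * w ^ k) = 1 - (\<pp> * w) ^ K"
      using one_diff_power_eq[of "\<pp> * w" K] by (simp add: power_mult_distrib)
    ultimately have T: "x * v * T = 1 - \<pp> ^ K * w ^ K"
      by (simp add: power_mult_distrib)
    have "x * v * s - 1 = x * v * (s - T) + (x * v * T - 1)" by (simp add: algebra_simps)
    also have "\<dots> = x * v * (s - T) - \<pp> ^ K * w ^ K" by (simp add: T)
    finally show ?thesis using s[of K] by (simp add: dvd_diff T_def)
  qed
  then have "x * (v * s) = 1" using padic_separated[of "x * v * s - 1"] by (simp add: mult.assoc)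
  then show "x dvd 1" by (metis dvd_triv_left)
qed

section \<open>Valuations\<close>

lemma padic_factor_unit:
  fixes x :: "'p :: prime_card padic_int"
  assumes "x \<noteq> 0"
  obtains n u where "x = \<pp> ^ n * u" "u dvd 1"
proof -
  obtain k where k: "\<not> \<pp> ^ k dvd x" using padic_separated assms by blast
  define n where "n = (LEAST k. \<not> \<pp> ^ Suc k dvd x)"
  have "\<not> \<pp> ^ Suc k dvd x" using k by (metis dvd_trans le_imp_power_dvd lessI less_imp_le)
  then have n: "\<not> \<pp> ^ Suc n dvd x" unfolding n_def by (rule LeastI)
  have "\<pp> ^ n dvd x"
  proof (cases n)
    case (Suc m)
    then show ?thesis using not_less_Least[of m "\<lambda>k. \<not> \<pp> ^ Suc k dvd x"] unfolding n_def by auto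
  qed simp
  then obtain u where u: "x = \<pp> ^ n * u" by (auto simp: dvd_def)
  have "\<not> \<pp> dvd u" using n u by (simp add: mult.commute[of _ "\<pp> ^ n"])
  then show ?thesis using u that padic_unit_iff by blast
qed

lemma padic_val_unit_mult:
  fixes u :: "'p :: prime_card padic_int"
  assumes "u dvd 1"
  shows "padic_val (\<pp> ^ n * u) = enat n"
proof -
  have u: "\<not> \<pp> dvd u" using assms padic_unit_iff by blast
  have "{k. \<pp> ^ k dvd \<pp> ^ n * u} = {..n}"
  proof (intro equalityI subsetI)
    fix k assume k: "k \<in> {k. \<pp> ^ k dvd \<pp> ^ n * u}"
    show "k \<in> {..n}"
    proof (rule ccontr)
      assume "k \<notin> {..n}"
      then have "\<pp> ^ Suc n dvd \<pp> ^ n * u" using k by (metis atMost_iff dvd_trans le_imp_power_dvd mem_Collect_eq not_less_eq_eq)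
      then show False using u by (simp add: mult.commute[of _ "\<pp> ^ n"])
    qed
  qed (auto intro: dvd_mult2 le_imp_power_dvd)
  moreover have "Max {..n} = n" by (rule Max_eqI) auto
  moreover have "\<pp> ^ n * u \<noteq> 0" using u by auto
  ultimately show ?thesis by (simp add: padic_val_def)
qed

lemma padic_val_0 [simp]: "padic_val 0 = \<infinity>"
  by (simp add: padic_val_def)

lemma padic_val_mult:
  "padic_val (x * y :: 'p :: prime_card padic_int) = padic_val x + padic_val y"
proof (cases "x = 0 \<or> y = 0")
  case False
  then obtain m u n v where *: "x = \<pp> ^ m * u" "u dvd 1" "y = \<pp> ^ n * v" "v dvd 1"
    using padic_factor_unit by metis
  have "x * y = \<pp> ^ (m + n) * (u * v)" by (simp add: * power_add)
  moreover have "u * v dvd 1" using * by simp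
  ultimately have "padic_val (x * y) = enat (m + n)" using padic_val_unit_mult by metis
  then show ?thesis using * by (simp add: padic_val_unit_mult)
qed auto

lemma padic_val_unit: "(u :: 'p :: prime_card padic_int) dvd 1 \<Longrightarrow> padic_val u = 0"
  using padic_val_unit_mult[of u 0] by (simp add: zero_enat_def)

lemma padic_val_prime_power [simp]: "padic_val (\<pp> ^ n :: 'p :: prime_card padic_int) = enat n"
  using padic_val_unit_mult[of 1 n] by simp

lemma padic_val_ge_iff:
  "enat n \<le> padic_val (x :: 'p :: prime_card padic_int) \<longleftrightarrow> \<pp> ^ n dvd x"
proof (cases "x = 0")
  case False
  then obtain m u where x: "x = \<pp> ^ m * u" "u dvd 1" using padic_factor_unit by blast
  show ?thesis
  proof
    assume "enat n \<le> padic_val x"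
    then show "\<pp> ^ n dvd x" using x by (simp add: padic_val_unit_mult le_imp_power_dvd dvd_mult2)
  next
    assume "\<pp> ^ n dvd x"
    then obtain z where "x = \<pp> ^ n * z" by (auto simp: dvd_def)
    then show "enat n \<le> padic_val x" by (simp add: padic_val_mult)
  qed
qed simp

section \<open>Factorials and binomial coefficients\<close>

text \<open>One round of Legendre's formula: only the multiples of p contribute to the p-part of n!,
  and their product is \<open>p ^ (n div p)\<close> times the factorial of
  \<open>n div p\<close>.\<close>

lemma multiplicity_fact_div:
  fixes p n :: nat
  assumes p: "prime p"
  shows "multiplicity p (fact n) = n div p + multiplicity p (fact (n div p))"
proof (induction n)
  case (Suc n)
  have mult: "multiplicity p (fact (Suc k) :: nat) = multiplicity p (Suc k) + multiplicity p (fact k)" for k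
    using p by (simp only: fact_Suc of_nat_id)
      (intro prime_elem_multiplicity_mult_distrib, auto)
  show ?case
  proof (cases "p dvd Suc n")
    case True
    then obtain k where k: "Suc n = p * k" by (auto simp: dvd_def)
    have div: "Suc n div p = Suc (n div p)" using True p by (simp add: div_Suc dvd_eq_mod_eq_0)
    then have "k = Suc (n div p)" using k p by (metis nonzero_mult_div_cancel_left not_prime_0)
    then have "multiplicity p (Suc n) = Suc (multiplicity p (Suc (n div p)))"
      using k p multiplicity_times_same[of "Suc (n div p)" p]
      by (metis Zero_not_Suc not_prime_0 not_prime_unit)
    then show ?thesis using Suc by (simp only: mult div)
  next
    case False
    then have "Suc n div p = n div p" by (simp add: div_Suc dvd_eq_mod_eq_0)
    moreover have "multiplicity p (Suc n) = 0" using False by (rule not_dvd_imp_multiplicity_0)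
    ultimately show ?thesis using Suc by (simp only: mult)
  qed
qed simp

text \<open>A consequence of v(n!) = (n - S) / (p - 1), where S is the base p digit sum of n; the
  inequality is strict because S is positive.\<close>

lemma multiplicity_fact_less:
  fixes p n :: nat
  assumes p: "prime p" and "0 < n"
  shows "(p - 1) * multiplicity p (fact n) < n"
  using assms(2)
proof (induction n rule: less_induct)
  case (less n)
  let ?q = "n div p"
  have p1: "1 < p" using p by (rule prime_gt_1_nat)
  have *: "multiplicity p (fact n) = ?q + multiplicity p (fact ?q)"
    by (rule multiplicity_fact_div[OF p])
  show ?case
  proof (cases "?q = 0")
    case True
    then have "multiplicity p (fact n) = 0" using * by simp
    then show ?thesis using less.prems by simp
  next
    case False
    have "?q < n" using p1 less.prems by simp
    then have IH: "(p - 1) * multiplicity p (fact ?q) < ?q" using less.IH False by simp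
    have "(p - 1) * multiplicity p (fact n) < (p - 1) * ?q + ?q"
      using IH by (simp add: * add_mult_distrib2)
    also have "\<dots> = p * ?q" using p1 by (cases p) auto
    also have "\<dots> \<le> n" by simp
    finally show ?thesis .
  qed
qed

lemma padic_fact_factor:
  obtains u where "(fact m :: 'p :: prime_card padic_int) = \<pp> ^ multiplicity CARD('p) (fact m) * u" "u dvd 1"
proof -
  let ?p = "CARD('p)"
  let ?k = "multiplicity ?p (fact m :: nat)"
  have p: "prime ?p" by (rule prime_card)
  obtain v where v: "(fact m :: nat) = ?p ^ ?k * v" "\<not> ?p dvd v"
    using multiplicity_decompose'[of "fact m :: nat" ?p] p by (metis fact_nonzero not_prime_unit)
  have "(fact m :: 'p padic_int) = of_nat (fact m)" by simp
  also have "\<dots> = \<pp> ^ ?k * of_nat v" by (subst v(1)) simp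
  finally have f: "(fact m :: 'p padic_int) = \<pp> ^ ?k * of_nat v" .
  have "\<not> (\<pp> :: 'p padic_int) dvd of_nat v"
  proof
    assume "(\<pp> :: 'p padic_int) dvd of_nat v"
    then have "Rep_padic_int (of_nat v :: 'p padic_int) 1 = 0"
      using padic_power_dvd_iff[of 1 "of_nat v :: 'p padic_int"] by simp
    then have "int v mod int ?p = 0" by (simp add: Rep_padic_int_of_nat)
    then show False using v(2) by (metis dvd_eq_mod_eq_0 of_nat_dvd_iff)
  qed
  then show ?thesis using f that padic_unit_iff by blast
qed

text \<open>Up to a unit m! is a power of p, so each divisibility by m! becomes an inequality
  between exponents.\<close>

lemma padic_fact_dvd_iff:
  "(fact m * \<pp> ^ j :: 'p :: prime_card padic_int) dvd x \<longleftrightarrow> \<pp> ^ (multiplicity CARD('p) (fact m) + j) dvd x"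
proof -
  obtain u where u: "(fact m :: 'p padic_int) = \<pp> ^ multiplicity CARD('p) (fact m) * u" "u dvd 1"
    by (rule padic_fact_factor)
  have "fact m * \<pp> ^ j = \<pp> ^ (multiplicity CARD('p) (fact m) + j) * u"
    by (simp add: u power_add)
  moreover have "\<pp> ^ k * u dvd x \<longleftrightarrow> \<pp> ^ k dvd x" for k
    using mult_dvd_mono[OF dvd_refl u(2), of "\<pp> ^ k"] by (auto dest: dvd_mult_left intro: dvd_trans)
  ultimately show ?thesis by simp
qed

lemma prod_diff_dvd:
  fixes t t' q :: "'a :: comm_ring_1"
  assumes "q dvd t - t'"
  shows "q dvd (\<Prod>i<m. t - of_nat i) - (\<Prod>i<m. t' - of_nat i)"
proof (induction m)
  case (Suc m)
  let ?A = "\<Prod>i<m. t - of_nat i" and ?B = "\<Prod>i<m. t' - of_nat i"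
  have "(\<Prod>i<Suc m. t - of_nat i) - (\<Prod>i<Suc m. t' - of_nat i)
    = (?A - ?B) * (t - of_nat m) + ?B * (t - t')"
    by (simp add: algebra_simps)
  then show ?case using Suc assms by (metis dvd_add dvd_mult dvd_mult2)
qed simp

lemma fact_dvd_falling_of_nat:
  "(fact m :: 'a :: {comm_ring_1, semiring_char_0}) dvd (\<Prod>i<m. of_nat n - of_nat i)"
proof (cases "m \<le> n")
  case True
  have "(\<Prod>i<m. of_nat n - of_nat i :: 'a) = of_nat (\<Prod>i<m. n - i)"
    using True by (auto simp: of_nat_diff intro!: prod.cong)
  also have "(\<Prod>i<m. n - i) = fact m * (n choose m)"
  proof -
    have "rat_of_nat (\<Prod>i<m. n - i) = (\<Prod>i = 0..<m. of_nat n - of_nat i)"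
      using True by (auto simp: of_nat_diff lessThan_atLeast0 intro!: prod.cong)
    also have "\<dots> = rat_of_nat (fact m * (n choose m))"
      by (simp add: gbinomial_mult_fact[symmetric] binomial_gbinomial)
    finally show ?thesis by (simp only: of_nat_eq_iff)
  qed
  finally show ?thesis by (simp add: of_nat_fact)
next
  case False
  then have "(\<Prod>i<m. of_nat n - of_nat i :: 'a) = 0" by (intro prod_zero) auto
  then show ?thesis by simp
qed

text \<open>Density of the natural numbers: modulo the p-part of m! the falling product depends only
  on the residue of t, and for natural t it is divisible by m!. This makes the quotient in
  \<open>padic_binomial\<close> exact.\<close>

lemma fact_dvd_falling:
  fixes t :: "'p :: prime_card padic_int"
  shows "fact m dvd (\<Prod>i<m. t - of_nat i)"
proof -
  let ?k = "multiplicity CARD('p) (fact m :: nat)"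
  obtain n :: nat where n: "\<pp> ^ ?k dvd t - of_nat n" by (rule padic_approx_of_nat)
  have "\<pp> ^ ?k dvd (\<Prod>i<m. t - of_nat i) - (\<Prod>i<m. of_nat n - of_nat i)"
    by (rule prod_diff_dvd[OF n])
  then have "fact m dvd (\<Prod>i<m. t - of_nat i) - (\<Prod>i<m. of_nat n - of_nat i)"
    using padic_fact_dvd_iff[where ?'p = 'p and j = 0] by simp
  then show ?thesis
    using fact_dvd_falling_of_nat[where ?'a = "'p padic_int" and m = m and n = n]
    by (metis dvd_add diff_add_cancel)
qed

lemma fact_mult_padic_binomial:
  "fact m * padic_binomial t m = (\<Prod>i<m. t - of_nat i)"
  unfolding padic_binomial_def using fact_dvd_falling[of m t] by auto

text \<open>The tail estimate: for m \<ge> d the quotient of \<open>p ^ m\<close> by m! is still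
  divisible by \<open>p ^ d\<close>. With d = 0 it gives v(m!) \<le> m.\<close>

lemma multiplicity_fact_add_le:
  fixes p m d :: nat
  assumes p: "prime p" and d: "d < p" "d \<le> m"
  shows "multiplicity p (fact m) + d \<le> m"
proof -
  let ?v = "multiplicity p (fact m :: nat)"
  show ?thesis
  proof (cases "m < p")
    case True
    then have "?v = 0" using multiplicity_fact_div[OF p, of m] by simp
    then show ?thesis using d by simp
  next
    case False
    \<comment> \<open>With p = q + 2 and v = v(m!), Legendre's bound reads (q + 1) v < m, while
      failure of the claim means m \<le> v + q because d \<le> q + 1. Together q v < q, so v = 0 and
      m \<le> q < p.\<close>
    define q where "q = p - 2"
    have q: "p = q + 2" using prime_ge_2_nat[OF p] by (simp add: q_def)
    have v: "(q + 1) * ?v < m" using multiplicity_fact_less[OF p, of m] False q by auto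
    show ?thesis
    proof (rule ccontr)
      assume "\<not> ?v + d \<le> m"
      then have m: "m \<le> ?v + q" using d q by simp
      then have "(q + 1) * ?v < ?v + q" using v by linarith
      then have "q * ?v < q * 1" unfolding add_mult_distrib by linarith
      then have "?v = 0" by (simp only: mult_less_cancel1 less_one)
      then show False using m False q by simp
    qed
  qed
qed

text \<open>For odd p the valuation of \<open>p ^ m\<close> divided by m! is therefore at least m /
  2 and tends to infinity.\<close>

lemma multiplicity_fact_odd:
  fixes p m :: nat
  assumes p: "prime p" "p \<noteq> 2"
  shows "2 * multiplicity p (fact m) \<le> m"
proof (cases "m = 0")
  case False
  have "3 \<le> p" using p prime_ge_2_nat[of p] by simp
  then have "2 * multiplicity p (fact m) \<le> (p - 1) * multiplicity p (fact m)"
    by (intro mult_right_mono) auto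
  then show ?thesis using multiplicity_fact_less[OF p(1), of m] False by linarith
qed simp

section \<open>Restricted power series\<close>

lemma fps_const_dvd_iff:
  "fps_const c dvd f \<longleftrightarrow> (\<forall>n. (c :: 'a :: comm_ring_1) dvd fps_nth f n)"
proof
  assume "\<forall>n. c dvd fps_nth f n"
  then obtain g where "\<forall>n. fps_nth f n = c * g n" unfolding dvd_def by metis
  then have "f = fps_const c * Abs_fps g" by (simp add: fps_eq_iff)
  then show "fps_const c dvd f" by simp
qed (auto simp: dvd_def)

lemma fps_separated:
  fixes f :: "'p :: prime_card padic_int fps"
  assumes "\<And>k. fps_const (\<pp> ^ k) dvd f"
  shows "f = 0"
proof (rule fps_ext)
  fix n show "fps_nth f n = fps_nth 0 n"
    using assms padic_separated[of "fps_nth f n"] by (simp add: fps_const_dvd_iff)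
qed

definition fps_truncate :: "nat \<Rightarrow> 'a :: zero fps \<Rightarrow> 'a poly"
  where "fps_truncate N f = Poly (map (fps_nth f) [0..<N])"

lemma coeff_fps_truncate: "Polynomial.coeff (fps_truncate N f) n = (if n < N then fps_nth f n else 0)"
  by (simp add: fps_truncate_def nth_default_def)

text \<open>Restrictedness becomes a congruence in the ring of all power series, so closure
  properties and evaluation follow from ring identities instead of estimates on single
  coefficients.\<close>

lemma restricted_series_iff:
  "f \<in> restricted_series \<longleftrightarrow>
    (\<forall>k. \<exists>q. fps_const (\<pp> ^ k) dvd (f :: 'p :: prime_card padic_int fps) - fps_of_poly q)"
proof safe
  fix k assume "f \<in> restricted_series"
  then obtain N where N: "\<forall>n\<ge>N. \<pp> ^ k dvd fps_nth f n" by (auto simp: restricted_series_def)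
  have "fps_const (\<pp> ^ k) dvd f - fps_of_poly (fps_truncate N f)"
    using N by (auto simp: fps_const_dvd_iff coeff_fps_truncate)
  then show "\<exists>q. fps_const (\<pp> ^ k) dvd f - fps_of_poly q" ..
next
  assume *: "\<forall>k. \<exists>q. fps_const (\<pp> ^ k) dvd f - fps_of_poly q"
  have "\<exists>N. \<forall>n\<ge>N. \<pp> ^ k dvd fps_nth f n" for k
  proof -
    obtain q where "fps_const (\<pp> ^ k) dvd f - fps_of_poly q" using * by blast
    then have "\<pp> ^ k dvd fps_nth f n - Polynomial.coeff q n" for n by (simp add: fps_const_dvd_iff)
    moreover have "Polynomial.coeff q n = 0" if "n \<ge> Suc (Polynomial.degree q)" for n
      using that by (simp add: Polynomial.coeff_eq_0)
    ultimately show ?thesis by (metis diff_zero)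
  qed
  then show "f \<in> restricted_series" by (simp add: restricted_series_def)
qed

lemma restricted_seriesE:
  fixes f :: "'p :: prime_card padic_int fps"
  assumes "f \<in> restricted_series"
  obtains q where "fps_const (\<pp> ^ k) dvd f - fps_of_poly q"
  using assms restricted_series_iff by blast

lemma restricted_of_poly [simp]: "fps_of_poly q \<in> restricted_series"
  by (auto simp: restricted_series_iff intro!: exI[of _ q])

lemma dvd_diff_mult:
  fixes a b c d q :: "'a :: comm_ring_1"
  assumes "q dvd a - b" "q dvd c - d"
  shows "q dvd a * c - b * d"
proof -
  have "a * c - b * d = (a - b) * c + b * (c - d)" by (simp add: algebra_simps)
  then show ?thesis using assms by simp
qed

lemma restricted_mult:
  fixes f g :: "'p :: prime_card padic_int fps"
  assumes "f \<in> restricted_series" "g \<in> restricted_series"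
  shows "f * g \<in> restricted_series"
  unfolding restricted_series_iff
proof
  fix k
  obtain q r where "fps_const (\<pp> ^ k) dvd f - fps_of_poly q" "fps_const (\<pp> ^ k) dvd g - fps_of_poly r"
    using assms restricted_seriesE by metis
  then have "fps_const (\<pp> ^ k) dvd f * g - fps_of_poly (q * r)"
    unfolding fps_of_poly_mult by (rule dvd_diff_mult)
  then show "\<exists>q. fps_const (\<pp> ^ k) dvd f * g - fps_of_poly q" ..
qed

lemma restricted_diff:
  fixes f g :: "'p :: prime_card padic_int fps"
  assumes "f \<in> restricted_series" "g \<in> restricted_series"
  shows "f - g \<in> restricted_series"
  unfolding restricted_series_iff
proof
  fix k
  obtain q r where "fps_const (\<pp> ^ k) dvd f - fps_of_poly q" "fps_const (\<pp> ^ k) dvd g - fps_of_poly r"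
    using assms restricted_seriesE by metis
  then have "fps_const (\<pp> ^ k) dvd (f - fps_of_poly q) - (g - fps_of_poly r)"
    by (rule dvd_diff)
  then have "fps_const (\<pp> ^ k) dvd f - g - fps_of_poly (q - r)"
    by (simp add: fps_of_poly_diff algebra_simps)
  then show "\<exists>q. fps_const (\<pp> ^ k) dvd f - g - fps_of_poly q" ..
qed

lemma restricted_cancel_prime:
  fixes f :: "'p :: prime_card padic_int fps"
  assumes "fps_const (\<pp> ^ s) * f \<in> restricted_series"
  shows "f \<in> restricted_series"
  unfolding restricted_series_def
proof (clarify)
  fix k
  obtain N where "\<forall>n\<ge>N. \<pp> ^ (s + k) dvd fps_nth (fps_const (\<pp> ^ s) * f) n"
    using assms unfolding restricted_series_def by blast
  then have "\<forall>n\<ge>N. \<pp> ^ k dvd fps_nth f n" by (simp add: power_add)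
  then show "\<exists>N. \<forall>n\<ge>N. \<pp> ^ k dvd fps_nth f n" ..
qed

text \<open>Once a partial sum reaches beyond the degree of \<open>q\<close>, it differs from
  \<open>poly q t\<close> by a multiple of \<open>p ^ k\<close>, term by term.\<close>

lemma restricted_eval_cong:
  fixes f :: "'p :: prime_card padic_int fps"
  assumes f: "f \<in> restricted_series" and q: "fps_const (\<pp> ^ k) dvd f - fps_of_poly q"
  shows "\<pp> ^ k dvd restricted_eval f t - poly q t"
proof -
  have "\<exists>N. \<forall>n\<ge>N. \<pp> ^ k dvd fps_nth f n * t ^ n" for k
    using f unfolding restricted_series_def by (blast intro: dvd_mult2)
  then obtain s where s: "padic_sums CARD('p) (\<lambda>n. fps_nth f n * t ^ n) s"
    using padic_sums_summable[of "\<lambda>n. fps_nth f n * t ^ n"] by blast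
  have eval: "restricted_eval f t = s"
    unfolding restricted_eval_def by (rule padic_suminf_eqI[OF padic_separated s])
  obtain N where N: "\<And>n. n \<ge> N \<Longrightarrow> \<pp> ^ k dvd (\<Sum>m<n. fps_nth f m * t ^ m) - s"
    using s unfolding padic_sums_def by blast
  define M where "M = max N (Suc (Polynomial.degree q))"
  have "poly q t = (\<Sum>m<M. Polynomial.coeff q m * t ^ m)"
    unfolding poly_altdef by (rule sum.mono_neutral_left) (auto simp: M_def Polynomial.coeff_eq_0)
  then have "(\<Sum>m<M. fps_nth f m * t ^ m) - poly q t = (\<Sum>m<M. (fps_nth f m - Polynomial.coeff q m) * t ^ m)"
    by (simp add: sum_subtractf algebra_simps)
  also have "\<pp> ^ k dvd \<dots>"
    using q by (intro dvd_sum dvd_mult2) (auto simp: fps_const_dvd_iff)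
  finally have "\<pp> ^ k dvd ((\<Sum>m<M. fps_nth f m * t ^ m) - poly q t) - ((\<Sum>m<M. fps_nth f m * t ^ m) - s)"
    by (rule dvd_diff) (simp add: N M_def)
  then show ?thesis unfolding eval by simp
qed

lemma restricted_eval_eqI:
  fixes f :: "'p :: prime_card padic_int fps"
  assumes "\<And>k. \<exists>q. fps_const (\<pp> ^ k) dvd f - fps_of_poly q \<and> \<pp> ^ k dvd s - poly q t"
  shows "restricted_eval f t = s"
proof -
  have f: "f \<in> restricted_series" using assms restricted_series_iff by blast
  have "\<pp> ^ k dvd restricted_eval f t - s" for k
  proof -
    obtain q where q: "fps_const (\<pp> ^ k) dvd f - fps_of_poly q" "\<pp> ^ k dvd s - poly q t"
      using assms by blast
    have "\<pp> ^ k dvd (restricted_eval f t - poly q t) - (s - poly q t)"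
      by (intro dvd_diff restricted_eval_cong f q)
    then show ?thesis by simp
  qed
  then show ?thesis using padic_separated[of "restricted_eval f t - s"] by simp
qed

lemma restricted_eval_of_poly [simp]: "restricted_eval (fps_of_poly q) t = poly q t"
  by (rule restricted_eval_eqI) (auto intro!: exI[of _ q])

lemma restricted_eval_mult:
  fixes f g :: "'p :: prime_card padic_int fps"
  assumes f: "f \<in> restricted_series" and g: "g \<in> restricted_series"
  shows "restricted_eval (f * g) t = restricted_eval f t * restricted_eval g t"
proof (rule restricted_eval_eqI)
  fix k
  obtain q r where q: "fps_const (\<pp> ^ k) dvd f - fps_of_poly q" "fps_const (\<pp> ^ k) dvd g - fps_of_poly r"
    using assms restricted_seriesE by metis
  have "fps_const (\<pp> ^ k) dvd f * g - fps_of_poly (q * r)"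
    unfolding fps_of_poly_mult using q by (rule dvd_diff_mult)
  moreover have "\<pp> ^ k dvd restricted_eval f t * restricted_eval g t - poly (q * r) t"
    unfolding poly_mult using restricted_eval_cong[OF f q(1)] restricted_eval_cong[OF g q(2)]
    by (rule dvd_diff_mult)
  ultimately show "\<exists>q. fps_const (\<pp> ^ k) dvd f * g - fps_of_poly q \<and>
      \<pp> ^ k dvd restricted_eval f t * restricted_eval g t - poly q t" by blast
qed

lemma restricted_eval_unit:
  fixes V :: "'p :: prime_card padic_int fps"
  assumes "V \<in> restricted_units"
  shows "restricted_eval V t dvd 1"
proof -
  obtain V' where "V \<in> restricted_series" "V' \<in> restricted_series" "V * V' = 1"
    using assms by (auto simp: restricted_units_def)
  then have "restricted_eval V t * restricted_eval V' t = 1"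
    using restricted_eval_mult[of V V' t] restricted_eval_of_poly[of 1 t] by simp
  then show ?thesis by (metis dvd_triv_left)
qed

text \<open>The degrees of the \<open>a k\<close> may be unbounded; the limit is restricted
  nevertheless, since modulo \<open>p ^ K\<close> only the first K polynomials contribute.\<close>

lemma restricted_series_limit:
  fixes a :: "nat \<Rightarrow> 'p :: prime_card padic_int poly"
  obtains s where "s \<in> restricted_series"
    "\<And>K. fps_const (\<pp> ^ K) dvd s - fps_of_poly (\<Sum>k<K. Polynomial.smult (\<pp> ^ k) (a k))"
proof -
  have "\<exists>s. \<forall>K. \<pp> ^ K dvd s - (\<Sum>k<K. \<pp> ^ k * Polynomial.coeff (a k) n)" for n
    using padic_power_series_limit[of "\<lambda>k. Polynomial.coeff (a k) n"] by metis
  then obtain s where s: "\<And>n K. \<pp> ^ K dvd s n - (\<Sum>k<K. \<pp> ^ k * Polynomial.coeff (a k) n)"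
    using choice[of "\<lambda>n s. \<forall>K. \<pp> ^ K dvd s - (\<Sum>k<K. \<pp> ^ k * Polynomial.coeff (a k) n)"] by blast
  have *: "fps_const (\<pp> ^ K) dvd Abs_fps s - fps_of_poly (\<Sum>k<K. Polynomial.smult (\<pp> ^ k) (a k))" for K
    using s by (simp add: fps_const_dvd_iff Polynomial.coeff_sum)
  then have "Abs_fps s \<in> restricted_series" unfolding restricted_series_iff by blast
  then show ?thesis using * that by blast
qed

subsection \<open>Reduction modulo \<open>p\<close>\<close>

lemma fps_nth_series_reduce [simp]: "fps_nth (series_reduce f) n = padic_reduce (fps_nth f n)"
  by (simp add: series_reduce_def)

lemma series_reduce_mult: "series_reduce (f * g) = series_reduce f * series_reduce g"
  by (simp add: fps_eq_iff fps_mult_nth padic_reduce.hom_sum padic_reduce.hom_mult)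

lemma series_reduce_eq_iff:
  "series_reduce f = series_reduce g \<longleftrightarrow> fps_const \<pp> dvd (f :: 'p :: prime_card padic_int fps) - g"
  by (simp add: fps_eq_iff fps_const_dvd_iff padic_reduce_eq_iff)

lemma series_reduce_of_poly: "series_reduce (fps_of_poly q) = fps_of_poly (map_poly padic_reduce q)"
  by (simp add: fps_eq_iff coeff_map_poly)

lemma restricted_reduce_poly:
  assumes "f \<in> restricted_series"
  obtains q where "series_reduce f = fps_of_poly q"
proof -
  obtain q where "fps_const (\<pp> ^ 1) dvd f - fps_of_poly q" using assms by (rule restricted_seriesE)
  then have "series_reduce f = series_reduce (fps_of_poly q)" by (simp add: series_reduce_eq_iff)
  then show ?thesis using that by (simp add: series_reduce_of_poly)
qed

text \<open>Over the residue field degrees add, so equal degrees leave only a nonzero constant for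
  \<open>f\<close>. This is how the cofactor in Weierstrass preparation turns out to be a
  unit.\<close>

lemma series_reduce_cofactor:
  fixes f g h :: "'p :: prime_card padic_int fps"
  assumes f: "f \<in> restricted_series" and "f * g = h"
    and a: "series_reduce g = fps_of_poly a" and b: "series_reduce h = fps_of_poly b"
    and "b \<noteq> 0" "Polynomial.degree a = Polynomial.degree b"
  obtains c where "c \<noteq> 0" "series_reduce f = fps_of_poly [:c:]"
proof -
  obtain r where r: "series_reduce f = fps_of_poly r" using f by (rule restricted_reduce_poly)
  have "fps_of_poly b = fps_of_poly (r * a)"
    using series_reduce_mult[of f g] by (simp add: assms r fps_of_poly_mult flip: a b)
  then have eq: "b = r * a" by (simp add: fps_of_poly_eq_iff)
  then have "Polynomial.degree b = Polynomial.degree r + Polynomial.degree a"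
    using \<open>b \<noteq> 0\<close> by (auto intro!: Polynomial.degree_mult_eq)
  then obtain c where "r = [:c:]" using assms by (metis add_right_imp_eq add_0 degree_eq_zeroE)
  moreover have "c \<noteq> 0" using \<open>b \<noteq> 0\<close> eq calculation by auto
  ultimately show ?thesis using that r by blast
qed

subsection \<open>Weierstrass division and preparation\<close>

text \<open>Pseudo-division multiplies \<open>h\<close> by a power of the leading coefficient, which
  its inverse undoes. The remainder is bounded through its coefficients, so that degree 0 of
  \<open>g\<close> correctly means a zero remainder.\<close>

lemma poly_division_unit_lead_coeff:
  fixes g h :: "'a :: idom poly"
  assumes "lead_coeff g dvd 1"
  obtains q r where "h = q * g + r" "\<And>n. n \<ge> Polynomial.degree g \<Longrightarrow> Polynomial.coeff r n = 0"
proof -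
  obtain w where w: "lead_coeff g * w = 1" using assms by (auto simp: dvd_def)
  obtain q r where qr: "pseudo_divmod h g = (q, r)" by force
  have "g \<noteq> 0" using w by auto
  define k where "k = Suc (Polynomial.degree h) - Polynomial.degree g"
  have 1: "Polynomial.smult (lead_coeff g ^ k) h = g * q + r"
    and 2: "r = 0 \<or> Polynomial.degree r < Polynomial.degree g"
    using pseudo_divmod[OF \<open>g \<noteq> 0\<close> qr] by (simp_all add: k_def)
  have "w ^ k * lead_coeff g ^ k = 1" using w by (metis mult.commute power_mult_distrib power_one)
  then have "h = Polynomial.smult (w ^ k) (Polynomial.smult (lead_coeff g ^ k) h)" by simp
  also have "\<dots> = Polynomial.smult (w ^ k) q * g + Polynomial.smult (w ^ k) r"
    unfolding 1 by (simp add: Polynomial.smult_add_right mult.commute)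
  finally show ?thesis
    by (rule that) (use 2 in \<open>auto simp: Polynomial.coeff_eq_0\<close>)
qed

text \<open>Modulo p the series \<open>G\<close> is its truncation \<open>G0\<close> at the degree
  of its reduction, a polynomial with unit leading coefficient, and \<open>h\<close> is a polynomial
  too; ordinary division then leaves an error divisible by p.\<close>

lemma weierstrass_division_step:
  fixes G h :: "'p :: prime_card padic_int fps"
  assumes G: "G \<in> restricted_series" and red: "series_reduce G = fps_of_poly \<Phi>" and "\<Phi> \<noteq> 0"
    and h: "h \<in> restricted_series"
  shows "\<exists>q r h'. (\<forall>n \<ge> Polynomial.degree \<Phi>. Polynomial.coeff r n = 0) \<and> h' \<in> restricted_series \<and>
    h = fps_of_poly q * G + fps_of_poly r + fps_const \<pp> * h'"
proof -
  let ?e = "Polynomial.degree \<Phi>"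
  have red': "padic_reduce (fps_nth G n) = Polynomial.coeff \<Phi> n" for n
    using arg_cong[OF red, of "\<lambda>f. fps_nth f n"] by simp
  define G0 where "G0 = fps_truncate (Suc ?e) G"
  have Ge: "\<not> \<pp> dvd fps_nth G ?e" using red'[of ?e] \<open>\<Phi> \<noteq> 0\<close> by (simp flip: padic_reduce_eq_0_iff)
  then have "fps_nth G ?e \<noteq> 0" by auto
  then have deg: "Polynomial.degree G0 = ?e"
    by (intro antisym Polynomial.degree_le Polynomial.le_degree) (auto simp: G0_def coeff_fps_truncate)
  have "\<pp> dvd fps_nth G n" if "n > ?e" for n
    using red'[of n] that by (simp add: Polynomial.coeff_eq_0 flip: padic_reduce_eq_0_iff)
  then have G0: "fps_const \<pp> dvd fps_of_poly G0 - G"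
    by (auto simp: fps_const_dvd_iff G0_def coeff_fps_truncate)
  have "lead_coeff G0 dvd 1" using Ge deg by (simp add: padic_unit_iff G0_def coeff_fps_truncate)
  obtain h0 where h0: "fps_const \<pp> dvd h - fps_of_poly h0"
    using restricted_seriesE[OF h, of 1] by auto
  obtain q r where qr: "h0 = q * G0 + r" "\<And>n. n \<ge> ?e \<Longrightarrow> Polynomial.coeff r n = 0"
    using poly_division_unit_lead_coeff[OF \<open>lead_coeff G0 dvd 1\<close>, of h0] unfolding deg by blast
  have "h - (fps_of_poly q * G + fps_of_poly r) = (h - fps_of_poly h0) + fps_of_poly q * (fps_of_poly G0 - G)"
    by (simp add: qr(1) fps_of_poly_add fps_of_poly_mult algebra_simps)
  also have "fps_const \<pp> dvd \<dots>" using h0 G0 by (intro dvd_add dvd_mult)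
  finally obtain h' where h': "h - (fps_of_poly q * G + fps_of_poly r) = fps_const \<pp> * h'"
    by (auto simp: dvd_def)
  have "h - fps_of_poly q * G - fps_of_poly r \<in> restricted_series"
    by (intro restricted_diff restricted_mult h G restricted_of_poly)
  then have "h' \<in> restricted_series"
    using restricted_cancel_prime[of 1 h'] h' by (simp add: algebra_simps)
  moreover have "h = fps_of_poly q * G + fps_of_poly r + fps_const \<pp> * h'"
    using h' by (simp add: algebra_simps)
  ultimately show ?thesis using qr(2) by blast
qed

lemma weierstrass_division:
  fixes G h :: "'p :: prime_card padic_int fps"
  assumes G: "G \<in> restricted_series" and red: "series_reduce G = fps_of_poly \<Phi>" and "\<Phi> \<noteq> 0"
    and h: "h \<in> restricted_series"
  obtains q r where "q \<in> restricted_series" "h = q * G + fps_of_poly r"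
    "\<And>n. n \<ge> Polynomial.degree \<Phi> \<Longrightarrow> Polynomial.coeff r n = 0"
proof -
  let ?e = "Polynomial.degree \<Phi>"
  let ?step = "\<lambda>h q r h'. (\<forall>n \<ge> ?e. Polynomial.coeff r n = 0) \<and> h' \<in> restricted_series \<and>
    h = fps_of_poly q * G + fps_of_poly r + fps_const \<pp> * h'"
  have "\<exists>H. H 0 = h \<and> (\<forall>k. H k \<in> restricted_series \<and> (\<exists>q r. ?step (H k) q r (H (Suc k))))"
  proof -
    have "\<exists>H. \<forall>k. (H k \<in> restricted_series \<and> (k = 0 \<longrightarrow> H k = h)) \<and> (\<exists>q r. ?step (H k) q r (H (Suc k)))"
    proof (rule dependent_nat_choice)
      fix g and k :: nat assume "g \<in> restricted_series \<and> (k = 0 \<longrightarrow> g = h)"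
      then obtain q r h' where "?step g q r h'"
        using weierstrass_division_step[OF G red \<open>\<Phi> \<noteq> 0\<close>, of g] by blast
      then show "\<exists>h'. (h' \<in> restricted_series \<and> (Suc k = 0 \<longrightarrow> h' = h)) \<and> (\<exists>q r. ?step g q r h')"
        by blast
    qed (use h in auto)
    then show ?thesis by blast
  qed
  then obtain H where H0: "H 0 = h" and "\<And>k. \<exists>q r. ?step (H k) q r (H (Suc k))" by blast
  then obtain a b where r0: "\<And>k n. n \<ge> ?e \<Longrightarrow> Polynomial.coeff (b k) n = 0"
    and step: "\<And>k. H k = fps_of_poly (a k) * G + fps_of_poly (b k) + fps_const \<pp> * H (Suc k)"
    by metis
  let ?S = "\<lambda>a K. \<Sum>k<K. Polynomial.smult (\<pp> ^ k) (a k)"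
  have sum: "h = fps_of_poly (?S a K) * G + fps_of_poly (?S b K) + fps_const (\<pp> ^ K) * H K" for K
  proof (induction K)
    case (Suc K)
    show ?case
      by (subst Suc) (subst step, simp add: fps_of_poly_add fps_of_poly_smult algebra_simps flip: fps_const_mult)
  qed (simp add: H0)
  obtain q where q: "q \<in> restricted_series" "\<And>K. fps_const (\<pp> ^ K) dvd q - fps_of_poly (?S a K)"
    using restricted_series_limit by blast
  obtain s where s: "s \<in> restricted_series" "\<And>K. fps_const (\<pp> ^ K) dvd s - fps_of_poly (?S b K)"
    using restricted_series_limit by blast
  \<comment> \<open>No approximate remainder has terms from degree e on, hence neither has the
    limit, which is therefore a polynomial.\<close>
  have s0: "fps_nth s n = 0" if "n \<ge> ?e" for n
  proof (rule padic_separated)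
    fix K
    have "\<pp> ^ K dvd fps_nth s n - (\<Sum>k<K. \<pp> ^ k * Polynomial.coeff (b k) n)"
      using s(2)[of K] by (simp add: fps_const_dvd_iff Polynomial.coeff_sum)
    then show "\<pp> ^ K dvd fps_nth s n" by (simp add: r0[OF that])
  qed
  define r where "r = fps_truncate ?e s"
  have r: "fps_of_poly r = s" using s0 by (auto simp: fps_eq_iff r_def coeff_fps_truncate)
  have "fps_const (\<pp> ^ K) dvd h - (q * G + s)" for K
  proof -
    have "h - (q * G + s) = fps_const (\<pp> ^ K) * H K - (q - fps_of_poly (?S a K)) * G - (s - fps_of_poly (?S b K))"
      by (subst sum[of K]) (simp add: algebra_simps)
    also have "fps_const (\<pp> ^ K) dvd \<dots>" by (intro dvd_diff dvd_mult2 q s dvd_refl)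
    finally show ?thesis .
  qed
  then have "h = q * G + s" using fps_separated[of "h - (q * G + s)"] by simp
  then show ?thesis by (intro that[of q r]) (simp_all add: q r, simp add: r_def coeff_fps_truncate)
qed

text \<open>The reduction has degree 0, so dividing 1 by \<open>f\<close> leaves no remainder and
  the quotient is the inverse.\<close>

lemma restricted_unitI:
  fixes f :: "'p :: prime_card padic_int fps"
  assumes f: "f \<in> restricted_series" and red: "series_reduce f = fps_of_poly [:c:]" and "c \<noteq> 0"
  obtains g where "g \<in> restricted_units" "f * g = 1"
proof -
  have "1 \<in> restricted_series" using restricted_of_poly[of 1] by simp
  then obtain g r where g: "g \<in> restricted_series" "1 = g * f + fps_of_poly r"
    "\<And>n. n \<ge> Polynomial.degree [:c:] \<Longrightarrow> Polynomial.coeff r n = 0"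
    using weierstrass_division[OF f red] \<open>c \<noteq> 0\<close> by (metis pCons_eq_0_iff)
  then have "r = 0" by (simp add: poly_eq_iff)
  then have "g * f = 1" using g by simp
  then show ?thesis using that[of g] g f by (auto simp: restricted_units_def mult.commute)
qed

lemma degree_monic_reduce:
  fixes W :: "'p :: prime_card padic_int poly"
  assumes "lead_coeff W = 1"
  shows "Polynomial.degree (map_poly padic_reduce W) = Polynomial.degree W" "map_poly padic_reduce W \<noteq> 0"
proof -
  have "Polynomial.coeff (map_poly padic_reduce W) (Polynomial.degree W) = 1"
    using assms by (simp add: coeff_map_poly)
  then have "Polynomial.coeff (map_poly padic_reduce W) (Polynomial.degree W) \<noteq> 0" by simp
  then show "Polynomial.degree (map_poly padic_reduce W) = Polynomial.degree W" "map_poly padic_reduce W \<noteq> 0"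
    by (metis antisym Polynomial.le_degree degree_map_poly_le, metis Polynomial.coeff_0)
qed

text \<open>Dividing X^e by \<open>G\<close> and moving the remainder to the left gives a monic W =
  q G of degree e. By degrees q reduces to a nonzero constant, so q is invertible, and V is its
  inverse.\<close>

lemma weierstrass_preparation:
  fixes G :: "'p :: prime_card padic_int fps"
  assumes G: "G \<in> restricted_series" and red: "series_reduce G = fps_of_poly \<Phi>" and "\<Phi> \<noteq> 0"
  obtains W V where "distinguished_poly W (Polynomial.degree \<Phi>)" "V \<in> restricted_units"
    "G = fps_of_poly W * V"
proof -
  let ?e = "Polynomial.degree \<Phi>"
  obtain q r where q: "q \<in> restricted_series"
    and qr: "fps_of_poly (Polynomial.monom 1 ?e) = q * G + fps_of_poly r"
    and r: "\<And>n. n \<ge> ?e \<Longrightarrow> Polynomial.coeff r n = 0"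
    using weierstrass_division[OF G red \<open>\<Phi> \<noteq> 0\<close> restricted_of_poly[of "Polynomial.monom 1 ?e"]] by blast
  define W where "W = Polynomial.monom 1 ?e - r"
  have "Polynomial.degree W = ?e"
    by (intro antisym Polynomial.degree_le Polynomial.le_degree) (auto simp: W_def r)
  then have W: "distinguished_poly W ?e" by (simp add: distinguished_poly_def) (simp add: W_def r)
  have qG: "q * G = fps_of_poly W" using qr by (simp add: W_def fps_of_poly_diff)
  obtain c where "c \<noteq> 0" "series_reduce q = fps_of_poly [:c:]"
    by (rule series_reduce_cofactor[OF q qG red series_reduce_of_poly])
      (use W degree_monic_reduce[of W] in \<open>auto simp: distinguished_poly_def\<close>)
  then obtain V where V: "V \<in> restricted_units" "q * V = 1" using restricted_unitI[OF q] by blast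
  have "fps_of_poly W * V = (q * V) * G" by (simp add: qG[symmetric] mult_ac)
  then show ?thesis using that[OF W V(1)] V by simp
qed

subsection \<open>Simple roots\<close>

text \<open>
  Hensel's lemma together with the exact distance to the root: on the disc \<open>c + p\<int>\<^sub>p\<close> the
  polynomial \<open>W(c + pX)\<close> is \<open>p\<close> times a series with reduction of degree 1, to which Weierstrass
  preparation applies.
\<close>

lemma simple_root_lift:
  fixes W :: "'p :: prime_card padic_int poly"
  assumes W0: "map_poly padic_reduce W \<noteq> 0"
    and ord: "Polynomial.order \<rho> (map_poly padic_reduce W) = 1"
  obtains \<tau> where "padic_reduce \<tau> = \<rho>"
    "\<And>t. padic_reduce t = \<rho> \<Longrightarrow> \<exists>u. u dvd 1 \<and> poly W t = (t - \<tau>) * u"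
proof -
  let ?r = "map_poly padic_reduce :: 'p padic_int poly \<Rightarrow> 'p mod_ring poly"
  interpret r: map_poly_comm_ring_hom "padic_reduce :: 'p padic_int \<Rightarrow> 'p mod_ring" ..
  obtain c where c: "padic_reduce c = \<rho>" using surj_padic_reduce by blast
  have poly_red: "poly (?r q) \<rho> = padic_reduce (poly q c)" for q
    using c by (metis padic_reduce.poly_map_poly)
  have split: "\<exists>q'. q = [:poly q c:] + [:-c, 1:] * q'" for q :: "'p padic_int poly"
  proof -
    have "[:-c, 1:] dvd q - [:poly q c:]" by (simp flip: poly_eq_0_iff_dvd)
    then show ?thesis by (metis dvdE diff_add_cancel add.commute)
  qed
  \<comment> \<open>Two divisions by X - c give the Taylor expansion W = W(c) + (X - c) Q1(c) + (X -
    c)^2 Q2, in which Q1(c) is the derivative W'(c).\<close>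
  obtain Q1 where Q1: "W = [:poly W c:] + [:-c, 1:] * Q1" using split by blast
  obtain Q2 where Q2: "Q1 = [:poly Q1 c:] + [:-c, 1:] * Q2" using split by blast
  have "poly (?r W) \<rho> = 0" using ord W0 by (simp add: order_root)
  then have "\<pp> dvd poly W c" by (simp add: poly_red padic_reduce_eq_0_iff)
  then obtain w where w: "poly W c = \<pp> * w" by (auto simp: dvd_def)
  have rW: "?r W = [:-\<rho>, 1:] * ?r Q1"
  proof -
    have "?r W = ?r ([:\<pp> * w:] + [:-c, 1:] * Q1)" using Q1 w by simp
    also have "\<dots> = ?r [:\<pp> * w:] + ?r [:-c, 1:] * ?r Q1"
      by (simp only: r.hom_add r.hom_mult)
    also have "?r [:\<pp> * w:] = 0"
      using padic_reduce_eq_0_iff[of "\<pp> * w"]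
      by (auto simp: poly_eq_iff coeff_map_poly coeff_pCons split: nat.splits)
    also have "?r [:-c, 1:] = [:-\<rho>, 1:]"
      using c by (simp add: map_poly_pCons padic_reduce.hom_uminus)
    also have "0 + [:-\<rho>, 1:] * ?r Q1 = [:-\<rho>, 1:] * ?r Q1" by (rule add_0)
    finally show ?thesis .
  qed
  \<comment> \<open>If p divided Q1(c), then \<rho> would be at least a double root of the reduction
    of W.\<close>
  have unit: "padic_reduce (poly Q1 c) \<noteq> 0"
  proof
    assume "padic_reduce (poly Q1 c) = 0"
    then have "[:-\<rho>, 1:] dvd ?r Q1" by (simp add: poly_red flip: poly_eq_0_iff_dvd)
    then have "[:-\<rho>, 1:] ^ 2 dvd ?r W" unfolding rW power2_eq_square by (rule mult_dvd_mono[OF dvd_refl])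
    then show False using ord W0 by (simp add: order_divides)
  qed
  \<comment> \<open>\<open>G\<close> is W(c + p X) / p: the quadratic term contributes (p X)^2 / p,
    which keeps a factor p, so the reduction is linear.\<close>
  define G where "G = [:w, poly Q1 c:] + Polynomial.smult \<pp> (Polynomial.monom 1 2 * pcompose Q2 [:c, \<pp>:])"
  have "fps_const \<pp> dvd fps_of_poly G - fps_of_poly [:w, poly Q1 c:]"
    by (simp add: G_def fps_of_poly_add fps_of_poly_smult)
  then have "series_reduce (fps_of_poly G) = series_reduce (fps_of_poly [:w, poly Q1 c:])"
    by (simp only: series_reduce_eq_iff)
  then have redG: "series_reduce (fps_of_poly G) = fps_of_poly [:padic_reduce w, padic_reduce (poly Q1 c):]"
    by (auto simp: fps_eq_iff coeff_pCons split: nat.splits)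
  obtain L V where L: "distinguished_poly L 1" and V: "V \<in> restricted_units" "fps_of_poly G = fps_of_poly L * V"
    using weierstrass_preparation[OF restricted_of_poly redG] unit by (auto split: if_splits)
  obtain x where x: "L = [:-x, 1:]"
  proof -
    have "Polynomial.coeff L 1 = 1" "Polynomial.degree L = 1" using L by (auto simp: distinguished_poly_def)
    then have "L = [:- (- Polynomial.coeff L 0), 1:]"
      by (intro poly_eqI) (auto simp: coeff_pCons Polynomial.coeff_eq_0 split: nat.splits)
    then show ?thesis by (rule that)
  qed
  show ?thesis
  proof (rule that)
    show "padic_reduce (c + \<pp> * x) = \<rho>"
      using c padic_reduce_eq_0_iff[of "\<pp> * x"] by (simp add: padic_reduce.hom_add)
    fix t :: "'p padic_int" assume t: "padic_reduce t = \<rho>"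
    then have "\<pp> dvd t - c" using c by (simp flip: padic_reduce_eq_iff)
    then obtain z where z: "t = c + \<pp> * z" by (auto simp: dvd_def algebra_simps)
    have "poly Q1 t = poly Q1 c + (t - c) * poly Q2 t"
      by (subst Q2) (simp add: algebra_simps)
    moreover have "poly W t = poly W c + (t - c) * poly Q1 t"
      by (subst Q1) (simp add: algebra_simps)
    ultimately have "poly W t = \<pp> * poly G z"
      by (simp add: w z G_def poly_pcompose poly_monom power2_eq_square algebra_simps)
    also have "poly G z = (z - x) * restricted_eval V z"
      using restricted_eval_mult[of "fps_of_poly L" V z] V x restricted_eval_of_poly[of G z]
      by (simp add: restricted_units_def)
    finally have "poly W t = (t - (c + \<pp> * x)) * restricted_eval V z"
      by (simp add: z algebra_simps)
    then show "\<exists>u. u dvd 1 \<and> poly W t = (t - (c + \<pp> * x)) * u"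
      using restricted_eval_unit[OF V(1)] by blast
  qed
qed

section \<open>Finite free algebras and the trace\<close>

locale finite_free_algebra = comm_ring_hom \<phi>
  for \<phi> :: "'r :: comm_ring_1 \<Rightarrow> 'a :: comm_ring_1" +
  fixes B :: "'a set"
  assumes finite_basis: "finite B" and basis: "alg_basis \<phi> B"
begin

sublocale M: Modules.module "alg_scale \<phi>"
  by (rule module_alg_scale) unfold_locales

lemma independent: "\<not> M.dependent B" and span: "M.span B = UNIV"
  using basis by (simp_all add: alg_basis_def)

definition coord :: "'a \<Rightarrow> 'a \<Rightarrow> 'r"
  where "coord b x = M.representation B x b"

lemma coord_add: "coord b (x + y) = coord b x + coord b y"
  by (simp add: coord_def M.representation_add independent span)

lemma coord_scale: "coord b (\<phi> r * x) = r * coord b x"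
  using M.representation_scale[OF independent, of x r] by (simp add: coord_def alg_scale_def span)

lemma coord_sum: "coord b (\<Sum>i\<in>I. f i) = (\<Sum>i\<in>I. coord b (f i))"
  by (simp add: coord_def M.representation_sum independent span)

lemma coord_expansion: "x = (\<Sum>b\<in>B. \<phi> (coord b x) * b)"
  using M.sum_representation_eq[OF independent _ finite_basis order_refl, of x]
  by (simp add: coord_def span alg_scale_def)

end

text \<open>Any vectors \<open>e i\<close> and functionals \<open>l i\<close> that reproduce every x
  compute the trace: express each b through the \<open>e i\<close>, each product
  \<open>y * e i\<close> through \<open>B'\<close>, and exchange the sums. This frees the trace from
  the basis picked by \<open>SOME\<close>.\<close>

lemma alg_trace_eq_sum_dual:
  fixes \<phi> :: "'r :: comm_ring_1 \<Rightarrow> 'a :: comm_ring_1"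
  assumes "finite_free_algebra \<phi> B"
    and add: "\<And>i x y. l i (x + y) = l i x + l i y"
    and scale: "\<And>i r x. l i (\<phi> r * x) = r * l i x"
    and expansion: "\<And>x. x = (\<Sum>i\<in>I. \<phi> (l i x) * e i)"
  shows "alg_trace \<phi> y = (\<Sum>i\<in>I. l i (y * e i))"
proof -
  interpret A: finite_free_algebra \<phi> B by fact
  define B' where "B' = (SOME B. finite B \<and> alg_basis \<phi> B)"
  have "finite B' \<and> alg_basis \<phi> B'"
    unfolding B'_def by (rule someI[of _ B]) (simp add: A.finite_basis A.basis)
  then interpret A': finite_free_algebra \<phi> B'
    by unfold_locales auto
  have l_zero: "l i 0 = 0" for i using add[of i 0 0] by simp
  have l_sum: "l i (\<Sum>b\<in>S. f b) = (\<Sum>b\<in>S. l i (f b))" for i S and f :: "'a \<Rightarrow> 'a"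
    by (induction S rule: infinite_finite_induct) (simp_all add: add l_zero)
  have "alg_trace \<phi> y = (\<Sum>b\<in>B'. A'.coord b (y * b))"
    by (simp add: alg_trace_def B'_def[symmetric] A'.coord_def Let_def)
  also have "\<dots> = (\<Sum>b\<in>B'. \<Sum>i\<in>I. l i b * A'.coord b (y * e i))"
  proof (rule sum.cong[OF refl])
    fix b
    have "y * b = (\<Sum>i\<in>I. \<phi> (l i b) * (y * e i))"
      by (subst expansion[of b]) (simp add: sum_distrib_left mult_ac)
    then show "A'.coord b (y * b) = (\<Sum>i\<in>I. l i b * A'.coord b (y * e i))"
      by (simp add: A'.coord_sum A'.coord_scale)
  qed
  also have "\<dots> = (\<Sum>i\<in>I. \<Sum>b\<in>B'. A'.coord b (y * e i) * l i b)"
    by (subst sum.swap) (simp add: mult.commute)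
  also have "\<dots> = (\<Sum>i\<in>I. l i (y * e i))"
  proof (rule sum.cong[OF refl])
    fix i
    have "l i (y * e i) = l i (\<Sum>b\<in>B'. \<phi> (A'.coord b (y * e i)) * b)"
      by (simp flip: A'.coord_expansion)
    then show "(\<Sum>b\<in>B'. A'.coord b (y * e i) * l i b) = l i (y * e i)"
      by (simp add: l_sum scale)
  qed
  finally show ?thesis .
qed

lemma finite_free_separated:
  fixes \<phi> :: "'p :: prime_card padic_int \<Rightarrow> 'a :: comm_ring_1"
  assumes "finite_free_algebra \<phi> B" and dvd: "\<And>k. of_nat CARD('p) ^ k dvd (x :: 'a)"
  shows "x = 0"
proof -
  interpret finite_free_algebra \<phi> B by fact
  have "coord b x = 0" for b
  proof (rule padic_separated)
    fix k
    obtain z where "x = of_nat CARD('p) ^ k * z" using dvd by (auto simp: dvd_def)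
    then have "x = \<phi> (\<pp> ^ k) * z" by (simp add: hom_power hom_of_nat)
    then show "\<pp> ^ k dvd coord b x" by (simp add: coord_scale)
  qed
  then show "x = 0" by (subst coord_expansion[of x]) simp
qed

lemma finite_free_torsion_free:
  fixes \<phi> :: "'p :: prime_card padic_int \<Rightarrow> 'a :: comm_ring_1"
  assumes "finite_free_algebra \<phi> B" and "r \<noteq> 0" and "\<phi> r * x = 0"
  shows "x = 0"
proof -
  interpret finite_free_algebra \<phi> B by fact
  have "coord b 0 = 0" for b using coord_add[of b 0 0] by simp
  then have "r * coord b x = 0" for b using assms(3) coord_scale[of b r x] by simp
  then have "coord b x = 0" for b using \<open>r \<noteq> 0\<close> by simp
  then show "x = 0" by (subst coord_expansion[of x]) simp
qed

lemma residue_class_eq_iff: "residue_class p x = residue_class p y \<longleftrightarrow> of_nat p dvd x - y"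
proof
  assume "residue_class p x = residue_class p y"
  moreover have "x \<in> residue_class p x" by (simp add: residue_class_def)
  ultimately show "of_nat p dvd x - y" by (simp add: residue_class_def)
next
  assume *: "of_nat p dvd x - y"
  have "of_nat p dvd z - x \<longleftrightarrow> of_nat p dvd z - y" for z
    using dvd_add_left_iff[OF *, of "z - x"] by simp
  then show "residue_class p x = residue_class p y" by (simp add: residue_class_def)
qed

subsection \<open>Power bases\<close>

lemma coeff_sum_monom:
  "Polynomial.coeff (\<Sum>i<d. Polynomial.monom (c i) i) n = (if n < d then c n else 0)"
  by (simp add: Polynomial.coeff_sum)

locale power_basis_algebra = comm_ring_hom \<phi>
  for \<phi> :: "'r :: idom \<Rightarrow> 'a :: comm_ring_1" +
  fixes d :: nat and U :: 'a
  assumes d_pos: "0 < d"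
    and span_powers: "\<And>x. \<exists>c. x = (\<Sum>i<d. \<phi> (c i) * U ^ i)"
    and independent_powers: "\<And>c i. (\<Sum>i<d. \<phi> (c i) * U ^ i) = 0 \<Longrightarrow> i < d \<Longrightarrow> c i = 0"
begin

definition cf :: "'a \<Rightarrow> nat \<Rightarrow> 'r"
  where "cf x = (\<lambda>i. if i < d then (SOME c. x = (\<Sum>i<d. \<phi> (c i) * U ^ i)) i else 0)"

lemma cf_expansion: "x = (\<Sum>i<d. \<phi> (cf x i) * U ^ i)"
proof -
  have "x = (\<Sum>i<d. \<phi> ((SOME c. x = (\<Sum>i<d. \<phi> (c i) * U ^ i)) i) * U ^ i)"
    by (rule someI_ex[OF span_powers])
  also have "\<dots> = (\<Sum>i<d. \<phi> (cf x i) * U ^ i)"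
    by (rule sum.cong) (simp_all add: cf_def)
  finally show ?thesis .
qed

lemma cf_ge: "i \<ge> d \<Longrightarrow> cf x i = 0"
  by (simp add: cf_def)

lemma cf_eqI: "x = (\<Sum>i<d. \<phi> (c i) * U ^ i) \<Longrightarrow> i < d \<Longrightarrow> cf x i = c i"
proof -
  assume x: "x = (\<Sum>i<d. \<phi> (c i) * U ^ i)" and i: "i < d"
  have "(\<Sum>i<d. \<phi> (cf x i - c i) * U ^ i) = (\<Sum>i<d. \<phi> (cf x i) * U ^ i) - (\<Sum>i<d. \<phi> (c i) * U ^ i)"
    by (simp add: hom_minus algebra_simps sum_subtractf)
  also have "\<dots> = 0" unfolding cf_expansion[symmetric] x[symmetric] by simp
  finally show "cf x i = c i" using independent_powers[of "\<lambda>i. cf x i - c i"] i by simp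
qed

lemma cf_add: "cf (x + y) i = cf x i + cf y i"
proof (cases "i < d")
  case True
  show ?thesis
  proof (rule cf_eqI[OF _ True])
    show "x + y = (\<Sum>i<d. \<phi> (cf x i + cf y i) * U ^ i)"
      by (simp add: hom_add distrib_right sum.distrib flip: cf_expansion)
  qed
qed (simp add: cf_ge)

lemma cf_scale: "cf (\<phi> r * x) i = r * cf x i"
proof (cases "i < d")
  case True
  show ?thesis
  proof (rule cf_eqI[OF _ True])
    have "\<phi> r * x = \<phi> r * (\<Sum>i<d. \<phi> (cf x i) * U ^ i)" by (simp flip: cf_expansion)
    then show "\<phi> r * x = (\<Sum>i<d. \<phi> (r * cf x i) * U ^ i)"
      by (simp add: hom_mult sum_distrib_left mult_ac)
  qed
qed (simp add: cf_ge)

lemma cf_0: "cf 0 i = 0"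
  using cf_scale[of 0 0] by simp

lemma cf_sum: "cf (\<Sum>j\<in>S. f j) i = (\<Sum>j\<in>S. cf (f j) i)"
  by (induction S rule: infinite_finite_induct) (simp_all add: cf_add cf_0)

lemma cf_power: "k < d \<Longrightarrow> i < d \<Longrightarrow> cf (U ^ k) i = (if i = k then 1 else 0)"
  by (rule cf_eqI) (simp_all add: if_distrib[of \<phi>] if_distrib[of "\<lambda>x. x * _"] sum.delta cong: if_cong)

definition ev :: "'r poly \<Rightarrow> 'a"
  where "ev g = poly (map_poly \<phi> g) U"

lemma ev_eq_sum: "\<forall>n\<ge>N. Polynomial.coeff g n = 0 \<Longrightarrow> ev g = (\<Sum>i<N. \<phi> (Polynomial.coeff g i) * U ^ i)"
proof -
  assume N: "\<forall>n\<ge>N. Polynomial.coeff g n = 0"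
  let ?g = "map_poly \<phi> g"
  have "ev g = (\<Sum>i\<le>Polynomial.degree ?g. Polynomial.coeff ?g i * U ^ i)" by (simp add: ev_def poly_altdef)
  also have "\<dots> = (\<Sum>i<max N (Suc (Polynomial.degree ?g)). Polynomial.coeff ?g i * U ^ i)"
    by (rule sum.mono_neutral_left) (use Polynomial.coeff_eq_0[of ?g] in \<open>auto simp del: coeff_map_poly_hom\<close>)
  also have "\<dots> = (\<Sum>i<N. Polynomial.coeff ?g i * U ^ i)"
    by (rule sum.mono_neutral_right) (use N in \<open>auto simp: coeff_map_poly\<close>)
  finally show ?thesis by (simp add: coeff_map_poly)
qed

lemma ev_add: "ev (g + h) = ev g + ev h" and ev_mult: "ev (g * h) = ev g * ev h"
  and ev_diff: "ev (g - h) = ev g - ev h"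
proof -
  interpret mp: map_poly_comm_ring_hom \<phi> ..
  show "ev (g + h) = ev g + ev h" "ev (g * h) = ev g * ev h" "ev (g - h) = ev g - ev h"
    by (simp_all add: ev_def mp.hom_add mp.hom_mult mp.hom_minus)
qed

lemma ev_const: "ev [:r:] = \<phi> r"
  by (subst ev_eq_sum[of 1]) (auto simp: coeff_pCons split: nat.splits)

lemma ev_X: "ev [:0, 1:] = U"
  by (subst ev_eq_sum[of 2]) (auto simp: coeff_pCons eval_nat_numeral split: nat.splits)

lemma ev_surj: "\<exists>g. ev g = x"
proof
  let ?g = "\<Sum>i<d. Polynomial.monom (cf x i) i"
  have "ev ?g = (\<Sum>i<d. \<phi> (cf x i) * U ^ i)"
    using ev_eq_sum[of d ?g] by (simp add: coeff_sum_monom)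
  then show "ev ?g = x" unfolding cf_expansion[symmetric] .
qed

section \<open>The minimal polynomial of U, Euler's trace formula and the derivative at U\<close>

definition minpoly :: "'r poly"
  where "minpoly = Polynomial.monom 1 d - (\<Sum>i<d. Polynomial.monom (cf (U ^ d) i) i)"

lemma coeff_minpoly:
  "Polynomial.coeff minpoly i = (if i < d then - cf (U ^ d) i else if i = d then 1 else 0)"
  by (simp add: minpoly_def coeff_sum_monom)

lemma degree_minpoly: "Polynomial.degree minpoly = d"
  by (intro antisym Polynomial.degree_le Polynomial.le_degree) (auto simp: coeff_minpoly)

lemma lead_coeff_minpoly: "lead_coeff minpoly = 1"
  by (simp add: degree_minpoly coeff_minpoly)

lemma ev_minpoly: "ev minpoly = 0"
proof -
  have "ev minpoly = (\<Sum>i<Suc d. \<phi> (Polynomial.coeff minpoly i) * U ^ i)"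
    by (rule ev_eq_sum) (simp add: coeff_minpoly)
  also have "\<dots> = U ^ d - (\<Sum>i<d. \<phi> (cf (U ^ d) i) * U ^ i)"
    by (simp add: coeff_minpoly hom_uminus sum_negf)
  finally show ?thesis by (simp flip: cf_expansion)
qed

text \<open>Division by the monic \<open>minpoly\<close> leaves a remainder of degree below d
  vanishing at U, and independence of the powers kills it. So the algebra is the quotient of the
  polynomial ring by \<open>minpoly\<close>.\<close>

lemma ev_eq_0_imp_minpoly_dvd:
  assumes "ev g = 0"
  shows "minpoly dvd g"
proof -
  obtain q r where g: "g = q * minpoly + r" and r: "\<And>n. n \<ge> d \<Longrightarrow> Polynomial.coeff r n = 0"
    using poly_division_unit_lead_coeff[of minpoly g] lead_coeff_minpoly degree_minpoly
    by (metis dvd_refl)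
  have "ev r = 0" using assms g by (simp add: ev_add ev_mult ev_minpoly)
  then have "(\<Sum>i<d. \<phi> (Polynomial.coeff r i) * U ^ i) = 0" using ev_eq_sum[of d r] r by simp
  then have "Polynomial.coeff r i = 0" if "i < d" for i
    using independent_powers[of "Polynomial.coeff r"] that by blast
  then have "r = 0" using r by (metis not_le poly_eq_iff Polynomial.coeff_0)
  then show ?thesis using g by simp
qed

text \<open>The functional \<open>top\<close> is the coefficient of \<open>U ^ (d - 1)\<close>. Its trace form has the dual basis
  \<open>dual\<close> formed by the coefficients of \<open>minpoly / (X - U)\<close>.\<close>

definition top :: "'a \<Rightarrow> 'r"
  where "top x = cf x (d - 1)"

definition dual :: "nat \<Rightarrow> 'a"
  where "dual j = (\<Sum>k<d. if j \<le> k then \<phi> (Polynomial.coeff minpoly (Suc k)) * U ^ (k - j) else 0)"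

lemma dual_last: "dual (d - 1) = 1"
proof -
  have "dual (d - 1) = (\<Sum>k\<in>{d - 1}. if d - 1 \<le> k then \<phi> (Polynomial.coeff minpoly (Suc k)) * U ^ (k - (d - 1)) else 0)"
    unfolding dual_def by (rule sum.mono_neutral_right) (use d_pos in auto)
  then show ?thesis using d_pos by (simp add: coeff_minpoly)
qed

text \<open>Horner's scheme for dividing \<open>minpoly\<close> by X - U: each coefficient of the
  quotient is U times the next one plus a coefficient of \<open>minpoly\<close>.\<close>

lemma dual_Suc:
  assumes "j < d"
  shows "dual j = U * dual (Suc j) + \<phi> (Polynomial.coeff minpoly (Suc j))"
proof -
  have "dual j = (\<Sum>k<d. U * (if Suc j \<le> k then \<phi> (Polynomial.coeff minpoly (Suc k)) * U ^ (k - Suc j) else 0)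
      + (if k = j then \<phi> (Polynomial.coeff minpoly (Suc j)) else 0))"
    unfolding dual_def
  proof (rule sum.cong[OF refl])
    fix k
    show "(if j \<le> k then \<phi> (Polynomial.coeff minpoly (Suc k)) * U ^ (k - j) else 0) =
      U * (if Suc j \<le> k then \<phi> (Polynomial.coeff minpoly (Suc k)) * U ^ (k - Suc j) else 0)
      + (if k = j then \<phi> (Polynomial.coeff minpoly (Suc j)) else 0)"
    proof (cases "Suc j \<le> k")
      case True
      then have "U ^ (k - j) = U * U ^ (k - Suc j)" by (metis Suc_diff_le diff_Suc_Suc power_Suc)
      then show ?thesis using True by (simp add: mult_ac)
    qed auto
  qed
  then show ?thesis using assms by (simp add: dual_def sum.distrib sum_distrib_left sum.delta)
qed

text \<open>Descent from j = d - 1, where \<open>dual\<close> is 1, by Horner's scheme. For k < d -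
  1 the correction \<open>top (U ^ k)\<close> vanishes; for k = d - 1 it is 1, and its factor
  cancels the coefficient of \<open>U ^ Suc j\<close> in \<open>U ^ d\<close>.\<close>

lemma top_dual:
  assumes "j < d" "k < d"
  shows "top (dual j * U ^ k) = (if j = k then 1 else 0)"
proof -
  have "i < d \<Longrightarrow> k < d \<Longrightarrow> top (dual (d - 1 - i) * U ^ k) = (if d - 1 - i = k then 1 else 0)" for i k
  proof (induction i arbitrary: k)
    case 0
    then show ?case by (auto simp: dual_last[simplified] top_def cf_power)
  next
    case (Suc i)
    define j where "j = d - 1 - Suc i"
    have j: "d - 1 - i = Suc j" "Suc j < d" using Suc.prems by (auto simp: j_def)
    have IH: "top (dual (Suc j) * U ^ k) = (if Suc j = k then 1 else 0)" if "k < d" for k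
      using Suc.IH[OF _ that] Suc.prems j by simp
    have "dual j * U ^ k = dual (Suc j) * U ^ Suc k + \<phi> (Polynomial.coeff minpoly (Suc j)) * U ^ k"
      using j by (simp add: dual_Suc algebra_simps)
    then have *: "top (dual j * U ^ k) = top (dual (Suc j) * U ^ Suc k) + Polynomial.coeff minpoly (Suc j) * top (U ^ k)"
      by (simp only: top_def cf_add cf_scale)
    have "top (dual j * U ^ k) = (if j = k then 1 else 0)"
    proof (cases "Suc k < d")
      case True
      then have "top (U ^ k) = 0" using cf_power[of k "d - 1"] by (simp add: top_def)
      then show ?thesis using * IH[OF True] by simp
    next
      case False
      then have k: "Suc k = d" using Suc.prems by simp
      have "dual (Suc j) * U ^ d = (\<Sum>i<d. \<phi> (cf (U ^ d) i) * (dual (Suc j) * U ^ i))"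
        by (subst cf_expansion[of "U ^ d"]) (simp add: sum_distrib_left mult_ac)
      then have "top (dual (Suc j) * U ^ d) = (\<Sum>i<d. cf (U ^ d) i * top (dual (Suc j) * U ^ i))"
        by (simp only: top_def cf_sum cf_scale)
      also have "\<dots> = (\<Sum>i<d. if Suc j = i then cf (U ^ d) i else 0)"
        by (rule sum.cong) (auto simp: IH)
      also have "\<dots> = cf (U ^ d) (Suc j)" using j by simp
      finally have "top (dual (Suc j) * U ^ Suc k) = cf (U ^ d) (Suc j)" by (simp only: k)
      moreover have "top (U ^ k) = 1" using k cf_power[of k "d - 1"] by (auto simp: top_def)
      ultimately show ?thesis using * j k by (simp add: coeff_minpoly)
    qed
    then show ?case by (simp add: j_def)
  qed
  from this[of "d - 1 - j" k] show ?thesis using assms by simp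
qed

lemma cf_eq_top_dual: "j < d \<Longrightarrow> cf x j = top (dual j * x)"
proof -
  assume j: "j < d"
  have "dual j * x = (\<Sum>i<d. \<phi> (cf x i) * (dual j * U ^ i))"
    by (subst cf_expansion[of x]) (simp add: sum_distrib_left mult_ac)
  then have "top (dual j * x) = (\<Sum>i<d. cf x i * top (dual j * U ^ i))"
    by (simp only: top_def cf_sum cf_scale)
  also have "\<dots> = (\<Sum>i<d. if j = i then cf x i else 0)"
    by (rule sum.cong) (auto simp: top_dual j)
  finally show ?thesis using j by simp
qed

text \<open>With f = \<open>minpoly\<close>, this is f'(U) as the value at U of f / (X - U): in the
  double sum the term of index k occurs once for each j \<le> k, that is k + 1 times.\<close>

lemma ev_pderiv_minpoly: "ev (pderiv minpoly) = (\<Sum>j<d. dual j * U ^ j)"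
proof -
  have "(\<Sum>j<d. dual j * U ^ j) =
    (\<Sum>j<d. \<Sum>k<d. if j \<le> k then \<phi> (Polynomial.coeff minpoly (Suc k)) * U ^ k else 0)"
  proof (rule sum.cong[OF refl])
    fix j
    have "U ^ (k - j) * U ^ j = U ^ k" if "j \<le> k" for k
      using that by (simp flip: power_add)
    then show "dual j * U ^ j =
      (\<Sum>k<d. if j \<le> k then \<phi> (Polynomial.coeff minpoly (Suc k)) * U ^ k else 0)"
      unfolding dual_def sum_distrib_right by (intro sum.cong) (auto simp: mult.assoc)
  qed
  also have "\<dots> = (\<Sum>k<d. \<Sum>j<d. if j \<le> k then \<phi> (Polynomial.coeff minpoly (Suc k)) * U ^ k else 0)"
    by (rule sum.swap)
  also have "\<dots> = (\<Sum>k<d. \<phi> (Polynomial.coeff (pderiv minpoly) k) * U ^ k)"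
  proof (rule sum.cong[OF refl])
    fix k assume "k \<in> {..<d}"
    then have "{..<d} \<inter> {j. j \<le> k} = {..k}" by auto
    then show "(\<Sum>j<d. if j \<le> k then \<phi> (Polynomial.coeff minpoly (Suc k)) * U ^ k else 0)
      = \<phi> (Polynomial.coeff (pderiv minpoly) k) * U ^ k"
      by (simp add: sum.If_cases coeff_pderiv hom_mult hom_add hom_of_nat algebra_simps)
  qed
  also have "\<dots> = ev (pderiv minpoly)"
    by (rule ev_eq_sum[symmetric]) (simp add: coeff_pderiv coeff_minpoly)
  finally show ?thesis by simp
qed

text \<open>The diagonal entry \<open>cf (x * U ^ j) j\<close> equals
  \<open>top (dual j * U ^ j * x)\<close>, and the multipliers of x add up to the derivative at
  U.\<close>

lemma alg_trace_eq_top: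
  assumes "finite_free_algebra \<phi> B"
  shows "alg_trace \<phi> x = top (ev (pderiv minpoly) * x)"
proof -
  have "alg_trace \<phi> x = (\<Sum>j<d. cf (x * U ^ j) j)"
    using assms by (rule alg_trace_eq_sum_dual) (use cf_add cf_scale cf_expansion in auto)
  also have "\<dots> = (\<Sum>j<d. top (dual j * U ^ j * x))"
    by (rule sum.cong) (auto simp: cf_eq_top_dual mult_ac)
  also have "\<dots> = top (\<Sum>j<d. dual j * U ^ j * x)" by (simp only: top_def cf_sum)
  also have "(\<Sum>j<d. dual j * U ^ j * x) = ev (pderiv minpoly) * x"
    by (simp add: ev_pderiv_minpoly sum_distrib_right)
  finally show ?thesis .
qed

text \<open>Differentiating polynomials in \<open>U\<close> gives a derivation of the algebra modulo the ideal
  generated by the derivative of \<open>minpoly\<close> at \<open>U\<close>. It sends \<open>U\<close> to 1, but must vanish.\<close>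

lemma unit_ev_pderiv_minpoly:
  assumes "kaehler_differentials_vanish \<phi>"
  shows "ev (pderiv minpoly) dvd 1"
proof -
  let ?f = "ev (pderiv minpoly)"
  \<comment> \<open>\<open>D\<close> depends on the polynomial chosen to represent x; two choices
    differ by a multiple of \<open>minpoly\<close>, which changes the derivative at U only by a
    multiple of \<open>?f\<close>.\<close>
  define D where "D x = ev (pderiv (SOME g. ev g = x))" for x
  have D_ev: "?f dvd D (ev g) - ev (pderiv g)" for g
  proof -
    define h where "h = (SOME h. ev h = ev g)"
    have "ev h = ev g" unfolding h_def by (rule someI) (rule refl)
    then have "ev (h - g) = 0" by (simp add: ev_diff)
    then have "minpoly dvd h - g" by (rule ev_eq_0_imp_minpoly_dvd)
    then obtain q where "h - g = minpoly * q" by (auto simp: dvd_def)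
    then have "pderiv h - pderiv g = minpoly * pderiv q + q * pderiv minpoly"
      by (metis pderiv_diff pderiv_mult)
    then have "ev (pderiv h) - ev (pderiv g) = ev q * ?f"
      by (metis ev_diff ev_add ev_mult ev_minpoly mult_zero_left add_0)
    then show ?thesis by (simp add: D_def h_def[symmetric])
  qed
  \<comment> \<open>The algebra-linear extension of dx \<mapsto> D x to the free module. It maps the
    defining relations of the differentials into the ideal of \<open>?f\<close>, hence everything,
    while dU goes to 1 modulo that ideal.\<close>
  define T where "T m = (\<Sum>x\<in>Poly_Mapping.keys m. Poly_Mapping.lookup m x * D x)" for m :: "'a \<Rightarrow>\<^sub>0 'a"
  have T_eq: "T m = (\<Sum>x\<in>A. Poly_Mapping.lookup m x * D x)" if "finite A" "Poly_Mapping.keys m \<subseteq> A" for m A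
    unfolding T_def using that by (intro sum.mono_neutral_left) (auto simp: in_keys_iff)
  have T_add: "T (m + n) = T m + T n" for m n
  proof -
    let ?A = "Poly_Mapping.keys m \<union> Poly_Mapping.keys n"
    have "T (m + n) = (\<Sum>x\<in>?A. Poly_Mapping.lookup (m + n) x * D x)"
      by (rule T_eq) (auto simp: Poly_Mapping.keys_add)
    moreover have "T m = (\<Sum>x\<in>?A. Poly_Mapping.lookup m x * D x)" by (rule T_eq) auto
    moreover have "T n = (\<Sum>x\<in>?A. Poly_Mapping.lookup n x * D x)" by (rule T_eq) auto
    ultimately show ?thesis by (simp add: lookup_add algebra_simps sum.distrib)
  qed
  have T_scale: "T (Poly_Mapping.map ((*) c) m) = c * T m" for c m
  proof -
    have l: "Poly_Mapping.lookup (Poly_Mapping.map ((*) c) m) x = c * Poly_Mapping.lookup m x" for x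
      by (simp add: Poly_Mapping.map.rep_eq when_def)
    have "T (Poly_Mapping.map ((*) c) m) = (\<Sum>x\<in>Poly_Mapping.keys m. c * Poly_Mapping.lookup m x * D x)"
      by (subst T_eq[of "Poly_Mapping.keys m"]) (auto simp: in_keys_iff l)
    then show ?thesis by (simp add: T_def sum_distrib_left mult.assoc)
  qed
  have T_single: "T (Poly_Mapping.single x a) = a * D x" for x a
    by (subst T_eq[of "{x}"]) auto
  have T_minus: "T (m - n) = T m - T n" for m n
    using T_add[of "m - n" n] by (simp add: algebra_simps)
  let ?S = "{m. ?f dvd T m}"
  let ?scale = "\<lambda>c :: 'a. Poly_Mapping.map ((*) c) :: ('a \<Rightarrow>\<^sub>0 'a) \<Rightarrow> _"
  have sub: "Modules.module.subspace ?scale ?S"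
    unfolding Modules.module.subspace_def[OF module_free_scale]
    by (auto simp: T_add T_scale) (simp add: T_def)
  have rel: "kaehler_relations \<phi> \<subseteq> ?S"
  proof
    fix m assume "m \<in> kaehler_relations \<phi>"
    then consider
      x y where "m = Poly_Mapping.single (x + y) 1 - Poly_Mapping.single x 1 - Poly_Mapping.single y 1"
      | x y where "m = Poly_Mapping.single (x * y) 1 - Poly_Mapping.single y x - Poly_Mapping.single x y"
      | r where "m = Poly_Mapping.single (\<phi> r) 1"
      unfolding kaehler_relations_def by blast
    then show "m \<in> ?S"
    proof cases
      case (1 x y)
      obtain g h where gh: "ev g = x" "ev h = y" using ev_surj by metis
      have "T m = D (x + y) - D x - D y" by (simp add: 1 T_minus T_single)
      also have "\<dots> = (D (ev (g + h)) - ev (pderiv (g + h))) - (D (ev g) - ev (pderiv g))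
          - (D (ev h) - ev (pderiv h))"
        by (simp add: gh ev_add pderiv_add)
      also have "?f dvd \<dots>" by (intro dvd_diff D_ev)
      finally show ?thesis by simp
    next
      case (2 x y)
      obtain g h where gh: "ev g = x" "ev h = y" using ev_surj by metis
      have "T m = D (x * y) - x * D y - y * D x" by (simp add: 2 T_minus T_single)
      also have "\<dots> = (D (ev (g * h)) - ev (pderiv (g * h))) - x * (D (ev h) - ev (pderiv h))
          - y * (D (ev g) - ev (pderiv g))"
        by (simp add: gh ev_add ev_mult pderiv_mult algebra_simps)
      also have "?f dvd \<dots>" by (intro dvd_diff dvd_mult D_ev)
      finally show ?thesis by simp
    next
      case (3 r)
      have "T m = D (ev [:r:]) - ev (pderiv [:r:])"
        using ev_const[of 0] by (simp add: 3 T_single ev_const pderiv_pCons)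
      then show ?thesis using D_ev[of "[:r:]"] by (simp only: mem_Collect_eq)
    qed
  qed
  have "UNIV \<subseteq> ?S"
    using Modules.module.span_minimal[OF module_free_scale rel sub] assms
    by (simp add: kaehler_differentials_vanish_def)
  then have "?f dvd T (Poly_Mapping.single U 1)" by blast
  then have "?f dvd D U" by (simp add: T_single)
  moreover have "?f dvd D U - 1"
    using D_ev[of "[:0, 1:]"] ev_const[of 1] by (simp add: ev_X pderiv_pCons)
  ultimately have "?f dvd D U - (D U - 1)" by (rule dvd_diff)
  then show ?thesis by simp
qed

end


subsection \<open>Lifting a basis from the residue algebra\<close>

text \<open>Each x has residue coefficients up to an error p x', and repeating this with x' yields
  p-adic digits for every coefficient. The limits represent x because the algebra is
  separated.\<close>

lemma residue_basis_span:
  fixes \<phi> :: "'p :: prime_card padic_int \<Rightarrow> 'a :: comm_ring_1"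
  assumes A: "finite_free_algebra \<phi> B" and rb: "residue_basis TYPE('p) d v"
  shows "\<exists>c. x = (\<Sum>i<d. \<phi> (c i) * v i)"
proof -
  interpret finite_free_algebra \<phi> B by fact
  let ?p = "of_nat CARD('p) :: 'a"
  have step: "\<exists>c x'. x = (\<Sum>i<d. \<phi> (c i) * v i) + ?p * x'" for x
  proof -
    obtain c :: "nat \<Rightarrow> 'p mod_ring" where
      "?p dvd x - (\<Sum>i<d. of_int (to_int_mod_ring (c i)) * v i)"
      using rb unfolding residue_basis_def residue_class_eq_iff by blast
    then obtain x' where "x - (\<Sum>i<d. of_int (to_int_mod_ring (c i)) * v i) = ?p * x'"
      by (auto simp: dvd_def)
    then have "x = (\<Sum>i<d. \<phi> (of_int (to_int_mod_ring (c i))) * v i) + ?p * x'"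
      by (simp add: hom_of_int algebra_simps)
    then show ?thesis
      by (intro exI[of _ "\<lambda>i. of_int (to_int_mod_ring (c i))"] exI[of _ x'])
  qed
  then obtain c g where step: "\<And>x. x = (\<Sum>i<d. \<phi> (c x i) * v i) + ?p * g x" by metis
  define X where "X k = (g ^^ k) x" for k
  have "\<exists>s. \<forall>K. \<pp> ^ K dvd s - (\<Sum>k<K. \<pp> ^ k * c (X k) i)" for i
    using padic_power_series_limit[of "\<lambda>k. c (X k) i"] by metis
  then obtain s where s: "\<And>i K. \<pp> ^ K dvd s i - (\<Sum>k<K. \<pp> ^ k * c (X k) i)"
    using choice[of "\<lambda>i s. \<forall>K. \<pp> ^ K dvd s - (\<Sum>k<K. \<pp> ^ k * c (X k) i)"] by blast
  have sum: "x = (\<Sum>i<d. \<phi> (\<Sum>k<K. \<pp> ^ k * c (X k) i) * v i) + ?p ^ K * X K" for K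
  proof (induction K)
    case (Suc K)
    have XK: "X K = (\<Sum>i<d. \<phi> (c (X K) i) * v i) + ?p * X (Suc K)"
      using step[of "X K"] by (simp add: X_def)
    have "?p ^ K * X K = (\<Sum>i<d. \<phi> (\<pp> ^ K * c (X K) i) * v i) + ?p ^ Suc K * X (Suc K)"
      by (subst XK) (simp add: hom_mult hom_power hom_of_nat distrib_left sum_distrib_left mult_ac)
    then show ?case using Suc
      by (simp add: hom_add distrib_right sum.distrib add.assoc)
  qed (simp add: X_def)
  have "?p ^ K dvd x - (\<Sum>i<d. \<phi> (s i) * v i)" for K
  proof -
    let ?S = "\<lambda>i. \<Sum>k<K. \<pp> ^ k * c (X k) i"
    have "x - (\<Sum>i<d. \<phi> (s i) * v i) = ?p ^ K * X K - (\<Sum>i<d. \<phi> (s i - ?S i) * v i)"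
      by (subst sum[of K]) (simp add: hom_minus left_diff_distrib sum_subtractf)
    also have "?p ^ K dvd \<dots>"
    proof (intro dvd_diff dvd_sum dvd_mult2 dvd_refl)
      fix i
      obtain z where "s i - ?S i = \<pp> ^ K * z" using s[of K i] by (auto simp: dvd_def)
      then show "?p ^ K dvd \<phi> (s i - ?S i)" by (simp add: hom_mult hom_power hom_of_nat)
    qed
    finally show ?thesis .
  qed
  then have "x - (\<Sum>i<d. \<phi> (s i) * v i) = 0" by (rule finite_free_separated[OF A])
  then show ?thesis by auto
qed

text \<open>Infinite descent: a relation has all coefficients divisible by p, and since the algebra
  is torsion-free it may be divided by p, so the coefficients are divisible by every power of
  p.\<close>

lemma residue_basis_independent:
  fixes \<phi> :: "'p :: prime_card padic_int \<Rightarrow> 'a :: comm_ring_1"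
  assumes A: "finite_free_algebra \<phi> B" and rb: "residue_basis TYPE('p) d v"
    and zero: "(\<Sum>i<d. \<phi> (c i) * v i) = 0" and "i < d"
  shows "c i = 0"
proof -
  interpret finite_free_algebra \<phi> B by fact
  let ?p = "of_nat CARD('p) :: 'a"
  have mod_p: "\<forall>i<d. \<pp> dvd c i" if zero: "(\<Sum>i<d. \<phi> (c i) * v i) = 0" for c
  proof -
    define r where "r i = padic_reduce (c i)" for i
    have "?p dvd (\<Sum>i<d. of_int (to_int_mod_ring (r i)) * v i) - (\<Sum>i<d. \<phi> (c i) * v i)"
      unfolding sum_subtractf[symmetric] left_diff_distrib[symmetric]
    proof (intro dvd_sum dvd_mult2)
      fix i
      have "padic_reduce (of_int (to_int_mod_ring (r i))) = padic_reduce (c i)"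
        by (simp add: r_def of_int_of_int_mod_ring)
      then obtain z where "of_int (to_int_mod_ring (r i)) - c i = \<pp> * z"
        unfolding padic_reduce_eq_iff by (auto simp: dvd_def)
      then have "\<phi> (of_int (to_int_mod_ring (r i)) - c i) = ?p * \<phi> z"
        by (simp add: hom_mult hom_of_nat)
      then show "?p dvd of_int (to_int_mod_ring (r i)) - \<phi> (c i)"
        by (simp add: hom_minus hom_of_int)
    qed
    then have "\<forall>i<d. r i = 0"
      using rb zero unfolding residue_basis_def residue_class_eq_iff by simp
    then show ?thesis by (simp add: r_def padic_reduce_eq_0_iff)
  qed
  have "\<forall>i<d. \<pp> ^ K dvd c i" for K
  proof (induction K)
    case (Suc K)
    then have "\<forall>i. \<exists>b. i < d \<longrightarrow> c i = \<pp> ^ K * b" by (auto simp: dvd_def)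
    then obtain b where b: "\<And>i. i < d \<Longrightarrow> c i = \<pp> ^ K * b i" by metis
    have "\<phi> (\<pp> ^ K) * (\<Sum>i<d. \<phi> (b i) * v i) = (\<Sum>i<d. \<phi> (c i) * v i)"
      by (simp add: b hom_mult sum_distrib_left mult.assoc)
    then have "\<phi> (\<pp> ^ K) * (\<Sum>i<d. \<phi> (b i) * v i) = 0" using zero by simp
    then have "(\<Sum>i<d. \<phi> (b i) * v i) = 0"
      using finite_free_torsion_free[OF A, of "\<pp> ^ K"] by simp
    then show ?case using mod_p[of b] b by (simp add: mult.commute mult_dvd_mono)
  qed simp
  then show ?thesis using \<open>i < d\<close> padic_separated by blast
qed

text \<open>Expanding x in powers of U turns the hypothesis into divisibility by p of
  \<open>top\<close> at x f'(U) y, for all x. For x = \<open>dual j\<close> these are the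
  coordinates of f'(U) y, and f'(U) is a unit.\<close>

lemma finite_etale_trace_nondegenerate:
  fixes \<phi> :: "'p :: prime_card padic_int \<Rightarrow> 'a :: comm_ring_1"
  assumes "finite_free_algebra \<phi> B" and "power_basis_algebra \<phi> d U"
    and kaehler: "kaehler_differentials_vanish \<phi>"
    and dvd: "\<And>m. m < d \<Longrightarrow> \<pp> dvd alg_trace \<phi> (y * U ^ m)"
  shows "of_nat CARD('p) dvd y"
proof -
  interpret power_basis_algebra \<phi> d U by fact
  let ?f = "ev (pderiv minpoly)" and ?p = "of_nat CARD('p) :: 'a"
  have *: "\<pp> dvd top (x * (?f * y))" for x
  proof -
    have "x * (?f * y) = (\<Sum>i<d. \<phi> (cf x i) * (?f * (y * U ^ i)))"
      by (subst cf_expansion[of x]) (simp add: sum_distrib_left sum_distrib_right mult_ac)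
    then have "top (x * (?f * y)) = (\<Sum>i<d. cf x i * top (?f * (y * U ^ i)))"
      by (simp only: top_def cf_sum cf_scale)
    then show ?thesis
      using dvd alg_trace_eq_top[OF assms(1)] by (auto intro!: dvd_sum dvd_mult)
  qed
  have "?p dvd (\<Sum>i<d. \<phi> (cf (?f * y) i) * U ^ i)"
  proof (intro dvd_sum dvd_mult2)
    fix i assume "i \<in> {..<d}"
    then have "\<pp> dvd cf (?f * y) i" using * by (simp add: cf_eq_top_dual)
    then obtain z where "cf (?f * y) i = \<pp> * z" by (auto simp: dvd_def)
    then show "?p dvd \<phi> (cf (?f * y) i)" by (simp add: hom_mult hom_of_nat)
  qed
  then have "?p dvd ?f * y" by (simp flip: cf_expansion)
  moreover obtain w where "?f * w = 1" using unit_ev_pderiv_minpoly[OF kaehler] by (auto simp: dvd_def)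
  then have "y = w * (?f * y)" by (metis mult.assoc mult.commute mult.left_neutral)
  ultimately show ?thesis by (metis dvd_mult)
qed

section \<open>Binomial series\<close>

definition falling_poly :: "nat \<Rightarrow> 'a :: comm_ring_1 poly"
  where "falling_poly m = (\<Prod>i<m. [:- of_nat i, 1:])"

lemma poly_falling_poly: "poly (falling_poly m) t = (\<Prod>i<m. t - of_nat i)"
  by (simp add: falling_poly_def poly_prod)

lemma coeff_falling_poly: "m \<le> n \<Longrightarrow> Polynomial.coeff (falling_poly m) n = (if n = m then 1 else 0)"
proof (induction m arbitrary: n)
  case 0
  then show ?case by (auto simp: falling_poly_def)
next
  case (Suc m)
  then obtain k where n: "n = Suc k" "m \<le> k" by (cases n) auto
  have "falling_poly (Suc m) = [:- of_nat m, 1:] * (falling_poly m :: 'a poly)"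
    by (simp add: falling_poly_def mult.commute)
  then show ?case using Suc.IH[of k] Suc.IH[of n] n by simp
qed

lemma map_falling_poly:
  fixes h :: "'a :: comm_ring_1 \<Rightarrow> 'b :: comm_ring_1"
  assumes "comm_ring_hom h"
  shows "map_poly h (falling_poly m) = falling_poly m"
proof -
  interpret comm_ring_hom h by fact
  interpret mp: map_poly_comm_ring_hom h ..
  show ?thesis
    unfolding falling_poly_def mp.hom_prod
    by (rule prod.cong) (auto simp: poly_eq_iff coeff_map_poly coeff_pCons hom_uminus hom_of_nat split: nat.splits)
qed

text \<open>All members are monic of distinct degrees, so the topmost coefficient is isolated first.
  Applied modulo p this shows that the leading polynomial is nonzero.\<close>

lemma falling_poly_independent:
  fixes r :: "nat \<Rightarrow> 'a :: comm_ring_1"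
  assumes "(\<Sum>m<d. Polynomial.smult (r m) (falling_poly m)) = 0" "m < d"
  shows "r m = 0"
  using assms
proof (induction d)
  case (Suc d)
  let ?S = "\<Sum>m<d. Polynomial.smult (r m) (falling_poly m)"
  have "Polynomial.coeff ?S d = 0"
    by (simp add: Polynomial.coeff_sum coeff_falling_poly)
  then have "Polynomial.coeff (\<Sum>m<Suc d. Polynomial.smult (r m) (falling_poly m)) d = r d"
    by (simp add: coeff_falling_poly)
  then have "r d = 0" using Suc.prems(1) by (simp only: Polynomial.coeff_0)
  then show ?case using Suc by (auto simp: less_Suc_eq)
qed simp

text \<open>Each coefficient of the sum is a series over m that converges because \<open>c m\<close>
  tends to 0. The second conclusion cuts the series at any N from which on \<open>c\<close> is
  divisible by \<open>p ^ k\<close>: with k = 1 it yields the reduction, with arbitrary k the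
  values.\<close>

lemma binomial_series_restricted:
  fixes c :: "nat \<Rightarrow> 'p :: prime_card padic_int"
  assumes c: "\<And>k. \<exists>N. \<forall>m\<ge>N. \<pp> ^ k dvd c m"
  obtains G where "G \<in> restricted_series"
    "\<And>k N. (\<And>m. m \<ge> N \<Longrightarrow> \<pp> ^ k dvd c m) \<Longrightarrow>
      fps_const (\<pp> ^ k) dvd G - fps_of_poly (\<Sum>m<N. Polynomial.smult (c m) (falling_poly m))"
proof -
  let ?a = "\<lambda>n m. c m * Polynomial.coeff (falling_poly m) n"
  have "\<exists>s. padic_sums CARD('p) (?a n) s" for n
  proof -
    have "\<exists>N. \<forall>m\<ge>N. \<pp> ^ k dvd ?a n m" for k
      using c[of k] by (blast intro: dvd_mult2)
    then show ?thesis using padic_sums_summable[of "?a n"] by blast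
  qed
  then obtain g where g: "\<And>n. padic_sums CARD('p) (?a n) (g n)" by metis
  have G: "fps_const (\<pp> ^ k) dvd Abs_fps g - fps_of_poly (\<Sum>m<N. Polynomial.smult (c m) (falling_poly m))"
    if N: "\<And>m. m \<ge> N \<Longrightarrow> \<pp> ^ k dvd c m" for k N
    unfolding fps_const_dvd_iff
  proof
    fix n
    obtain M where M: "\<And>l. l \<ge> M \<Longrightarrow> \<pp> ^ k dvd (\<Sum>m<l. ?a n m) - g n"
      using g[of n] unfolding padic_sums_def by blast
    let ?L = "max M N"
    have "(\<Sum>m<?L. ?a n m) - (\<Sum>m<N. ?a n m) = (\<Sum>m\<in>{N..<?L}. ?a n m)"
      using sum_diff_nat_ivl[of 0 N ?L "?a n"] by (simp add: lessThan_atLeast0)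
    also have "\<pp> ^ k dvd \<dots>" by (intro dvd_sum dvd_mult2 N) auto
    finally have "\<pp> ^ k dvd ((\<Sum>m<?L. ?a n m) - (\<Sum>m<N. ?a n m)) - ((\<Sum>m<?L. ?a n m) - g n)"
      by (rule dvd_diff) (simp add: M)
    then show "\<pp> ^ k dvd fps_nth (Abs_fps g - fps_of_poly (\<Sum>m<N. Polynomial.smult (c m) (falling_poly m))) n"
      by (simp add: Polynomial.coeff_sum)
  qed
  have "Abs_fps g \<in> restricted_series"
    unfolding restricted_series_iff using G c by blast
  then show ?thesis using that G by blast
qed

section \<open>Zeros and simple roots of a factored series\<close>

lemma weierstrass_zeros:
  fixes FX :: "'p :: prime_card padic_int fps"
  assumes WV: "weierstrass_factorization FX s e W V"
  shows "restricted_eval FX t = \<pp> ^ s * poly W t * restricted_eval V t"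
    and "{t. restricted_eval FX t = 0} = {t. poly W t = 0}"
    and "finite {t. restricted_eval FX t = 0}"
    and "(\<Sum>t | restricted_eval FX t = 0. Polynomial.order t W) \<le> e"
proof -
  have W: "lead_coeff W = 1" "Polynomial.degree W = e" and V: "V \<in> restricted_units"
    and FX: "FX = fps_const (\<pp> ^ s) * fps_of_poly W * V"
    using WV by (auto simp: weierstrass_factorization_def distinguished_poly_def)
  have *: "restricted_eval FX t = \<pp> ^ s * poly W t * restricted_eval V t" for t
  proof -
    have "FX = fps_of_poly (Polynomial.smult (\<pp> ^ s) W) * V"
      by (simp add: FX fps_of_poly_smult)
    then have "restricted_eval FX t = restricted_eval (fps_of_poly (Polynomial.smult (\<pp> ^ s) W)) t * restricted_eval V t"
      using V by (simp only: restricted_eval_mult restricted_of_poly restricted_units_def mem_Collect_eq)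
    then show ?thesis by simp
  qed
  then show "restricted_eval FX t = \<pp> ^ s * poly W t * restricted_eval V t" .
  have "restricted_eval V t \<noteq> 0" for t using restricted_eval_unit[OF V, of t] by auto
  then show zeros: "{t. restricted_eval FX t = 0} = {t. poly W t = 0}" by (simp add: *)
  have "W \<noteq> 0" using W by auto
  then show "finite {t. restricted_eval FX t = 0}" unfolding zeros by (rule poly_roots_finite)
  show "(\<Sum>t | restricted_eval FX t = 0. Polynomial.order t W) \<le> e"
    unfolding zeros using sum_order_le_degree[OF \<open>W \<noteq> 0\<close>] W by simp
qed

text \<open>\<Phi> is a nonzero constant times the reduction of W, so \<rho> is a simple root there
  as well; the value of V is a unit and does not affect the valuation.\<close>

lemma restricted_simple_root:
  fixes G :: "'p :: prime_card padic_int fps"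
  assumes G: "G \<in> restricted_series" and red: "series_reduce G = fps_of_poly \<Phi>" and "\<Phi> \<noteq> 0"
    and ord: "Polynomial.order \<rho> \<Phi> = 1"
  obtains \<tau> where "padic_reduce \<tau> = \<rho>"
    "\<And>t. padic_reduce t = \<rho> \<Longrightarrow> padic_val (restricted_eval G t) = padic_val (t - \<tau>)"
proof -
  obtain W V where W: "distinguished_poly W (Polynomial.degree \<Phi>)" and V: "V \<in> restricted_units"
    and GWV: "G = fps_of_poly W * V"
    using weierstrass_preparation[OF G red \<open>\<Phi> \<noteq> 0\<close>] by blast
  let ?W = "map_poly padic_reduce W"
  have W': "lead_coeff W = 1" "Polynomial.degree W = Polynomial.degree \<Phi>"
    using W by (auto simp: distinguished_poly_def)
  have Vr: "V \<in> restricted_series" using V by (simp add: restricted_units_def)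
  obtain c where c: "c \<noteq> 0" "series_reduce V = fps_of_poly [:c:]"
    by (rule series_reduce_cofactor[OF Vr _ series_reduce_of_poly red \<open>\<Phi> \<noteq> 0\<close>, of W])
      (use W' degree_monic_reduce[OF W'(1)] GWV in \<open>auto simp: mult.commute\<close>)
  have "fps_of_poly \<Phi> = fps_of_poly (Polynomial.smult c ?W)"
  proof -
    have "fps_of_poly \<Phi> = fps_of_poly ?W * fps_of_poly [:c:]"
      by (simp only: red[symmetric] GWV series_reduce_mult series_reduce_of_poly c(2))
    also have "\<dots> = fps_of_poly (?W * [:c:])" by (rule fps_of_poly_mult[symmetric])
    finally show ?thesis by (simp add: mult.commute[of ?W])
  qed
  then have "\<Phi> = Polynomial.smult c ?W" by (simp only: fps_of_poly_eq_iff)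
  then have ordW: "Polynomial.order \<rho> ?W = 1" using ord c by (simp add: order_smult)
  obtain \<tau> where \<tau>: "padic_reduce \<tau> = \<rho>"
    "\<And>t. padic_reduce t = \<rho> \<Longrightarrow> \<exists>u. u dvd 1 \<and> poly W t = (t - \<tau>) * u"
    using simple_root_lift[OF degree_monic_reduce(2)[OF W'(1)] ordW] by blast
  show ?thesis
  proof (rule that[OF \<tau>(1)])
    fix t assume "padic_reduce t = \<rho>"
    then obtain u where u: "u dvd 1" "poly W t = (t - \<tau>) * u" using \<tau>(2) by blast
    have "restricted_eval G t = (t - \<tau>) * u * restricted_eval V t"
      by (simp add: GWV restricted_eval_mult Vr u)
    then show "padic_val (restricted_eval G t) = padic_val (t - \<tau>)"
      using u restricted_eval_unit[OF V, of t] by (simp add: padic_val_mult padic_val_unit)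
  qed
qed

section \<open>Minimal slope and leading polynomial\<close>

lemma min_slope_eqD:
  fixes C :: "nat \<Rightarrow> 'p :: prime_card padic_int"
  assumes d: "0 < d" and s: "min_slope d C = enat s"
  shows "m < d \<Longrightarrow> enat s \<le> enat m + padic_val (C m)"
    and "\<exists>m<d. enat m + padic_val (C m) = enat s"
proof -
  let ?S = "(\<lambda>m. enat m + padic_val (C m)) ` {..<d}"
  have "finite ?S" "?S \<noteq> {}" using d by auto
  then have "Min ?S \<in> ?S" "\<And>x. x \<in> ?S \<Longrightarrow> Min ?S \<le> x" by auto
  then show "m < d \<Longrightarrow> enat s \<le> enat m + padic_val (C m)"
    and "\<exists>m<d. enat m + padic_val (C m) = enat s"
    using s unfolding min_slope_def by auto
qed

lemma padic_fact_unit: "m < CARD('p) \<Longrightarrow> (fact m :: 'p :: prime_card padic_int) dvd 1"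
proof -
  assume "m < CARD('p)"
  then have "multiplicity CARD('p) (fact m :: nat) = 0"
    using multiplicity_fact_div[OF prime_card[where ?'a = 'p], of m] by simp
  then show ?thesis using padic_fact_dvd_iff[where ?'p = 'p and j = 0] by simp
qed

text \<open>Since m! is a unit for m < d, the valuation of \<open>c m\<close> is m + v(C m) - s, and
  the coefficients prime to p are exactly those on the minimal slope. The denominator m! of
  \<open>binomial_poly\<close> is already contained in \<open>c m\<close>.\<close>

lemma leading_poly_eq:
  fixes C c :: "nat \<Rightarrow> 'p :: prime_card padic_int"
  assumes d: "0 < d" "d < CARD('p)" and s: "min_slope d C = enat s"
    and c: "\<And>m. fact m * \<pp> ^ s * c m = \<pp> ^ m * C m"
  shows "leading_poly d s C = (\<Sum>m<d. Polynomial.smult (padic_reduce (c m)) (falling_poly m))"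
    and "\<exists>m<d. padic_reduce (c m) \<noteq> 0"
proof -
  have fact: "padic_reduce (fact m :: 'p padic_int) \<noteq> 0" "padic_reduce (fact m :: 'p padic_int) = of_nat (fact m)"
    if "m < d" for m
    using padic_fact_unit[where ?'p = 'p and m = m] that d padic_unit_iff padic_reduce_eq_0_iff
      padic_reduce.hom_of_nat[of "fact m"] by (auto simp: of_nat_fact)
  have val: "padic_val (c m) + enat s = enat m + padic_val (C m)" if "m < d" for m
    using arg_cong[OF c[of m], of padic_val] padic_fact_unit[where ?'p = 'p and m = m] that d
    by (simp add: padic_val_mult padic_val_unit add.commute)
  have zero_iff: "padic_reduce (c m) = 0 \<longleftrightarrow> enat m + padic_val (C m) \<noteq> enat s" if "m < d" for m
  proof -
    have "padic_reduce (c m) = 0 \<longleftrightarrow> enat 1 \<le> padic_val (c m)"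
      using padic_val_ge_iff[of 1 "c m"] by (simp add: padic_reduce_eq_0_iff)
    also have "\<dots> \<longleftrightarrow> padic_val (c m) + enat s \<noteq> enat s"
      by (cases "padic_val (c m)") auto
    finally show ?thesis using val[OF that] by simp
  qed
  show "\<exists>m<d. padic_reduce (c m) \<noteq> 0" using min_slope_eqD(2)[OF d(1) s] zero_iff by auto
  have lead: "Polynomial.smult (padic_reduce (C m div \<pp> ^ (s - m))) (binomial_poly m)
      = Polynomial.smult (padic_reduce (c m)) (falling_poly m)"
    if m: "m < d" "enat m + padic_val (C m) = enat s" for m
  proof -
    \<comment> \<open>Equality of slopes bounds m by s, so the truncated difference s - m is the
      true one and the division is exact.\<close>
    have "m \<le> s" using m(2) by (cases "padic_val (C m)") auto
    then have "\<pp> ^ m * (\<pp> ^ (s - m) * (fact m * c m)) = \<pp> ^ m * C m"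
      using c[of m] by (simp add: mult_ac flip: power_add)
    then have "C m = \<pp> ^ (s - m) * (fact m * c m)" by simp
    then have "C m div \<pp> ^ (s - m) = fact m * c m" by simp
    then have "padic_reduce (C m div \<pp> ^ (s - m)) = of_nat (fact m) * padic_reduce (c m)"
      using fact(2)[OF m(1)] by (simp add: padic_reduce.hom_mult)
    moreover have "of_nat (fact m) \<noteq> (0 :: 'p mod_ring)" using fact[OF m(1)] by simp
    ultimately have "padic_reduce (C m div \<pp> ^ (s - m)) * inverse (of_nat (fact m)) = padic_reduce (c m)"
      using nonzero_mult_div_cancel_left[of "of_nat (fact m)" "padic_reduce (c m)"]
      by (simp only: divide_inverse not_False_eq_True)
    then show ?thesis by (simp only: binomial_poly_def falling_poly_def Polynomial.smult_smult)
  qed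
  let ?I = "{m. m < d \<and> enat m + padic_val (C m) = enat s}"
  have "leading_poly d s C = (\<Sum>m\<in>?I. Polynomial.smult (padic_reduce (c m)) (falling_poly m))"
    unfolding leading_poly_def by (rule sum.cong) (use lead in auto)
  also have "\<dots> = (\<Sum>m<d. Polynomial.smult (padic_reduce (c m)) (falling_poly m))"
    by (rule sum.mono_neutral_left) (use zero_iff in auto)
  finally show "leading_poly d s C = (\<Sum>m<d. Polynomial.smult (padic_reduce (c m)) (falling_poly m))" .
qed

lemma dvd_diff_swap: "q dvd a - b \<longleftrightarrow> q dvd b - (a :: 'a :: comm_ring_1)"
  by (metis dvd_minus_iff minus_diff_eq)

text \<open>\<open>conv\<close> is a separate assumption because the tail estimate yields only the
  power \<open>p ^ Suc s\<close>, enough for the reduction, whereas a restricted series demands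
  every power.\<close>

lemma binomial_series_weierstrass:
  fixes C :: "nat \<Rightarrow> 'p :: prime_card padic_int" and F :: "'p padic_int \<Rightarrow> 'p padic_int"
  assumes d: "0 < d" "d < CARD('p)" and s: "min_slope d C = enat s" "s < d"
    and conv: "\<And>k. \<exists>N. \<forall>m\<ge>N. fact m * \<pp> ^ k dvd \<pp> ^ m * C m"
    and F: "\<And>t n. \<pp> ^ n dvd (\<Sum>m<n. padic_binomial t m * (\<pp> ^ m * C m)) - F t"
  obtains G where "G \<in> restricted_series" "series_reduce G = fps_of_poly (leading_poly d s C)"
    "leading_poly d s C \<noteq> 0" "Polynomial.degree (leading_poly d s C) \<le> d - 1"
    "\<And>t. restricted_eval (fps_const (\<pp> ^ s) * G) t = F t"
proof -
  \<comment> \<open>Here s \<le> d - 1 pays off: v(m!) + s + 1 \<le> v(m!) + d \<le> m.\<close>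
  have tail: "fact m * \<pp> ^ Suc s dvd \<pp> ^ m * C m" if "m \<ge> d" for m
  proof -
    have "multiplicity CARD('p) (fact m) + Suc s \<le> m"
      using multiplicity_fact_add_le[OF prime_card[where ?'a = 'p] d(2) that] s(2) by simp
    then show ?thesis unfolding padic_fact_dvd_iff by (intro dvd_mult2 le_imp_power_dvd)
  qed
  have "fact m * \<pp> ^ s dvd \<pp> ^ m * C m" for m
  proof (cases "m < d")
    case True
    then have "enat s \<le> padic_val (\<pp> ^ m * C m)"
      using min_slope_eqD(1)[OF d(1) s(1)] by (simp add: padic_val_mult)
    then have "\<pp> ^ s dvd \<pp> ^ m * C m" by (simp only: padic_val_ge_iff)
    moreover have "fact m * \<pp> ^ s dvd 1 * (\<pp> ^ s :: 'p padic_int)"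
      using padic_fact_unit[where ?'p = 'p and m = m] True d by (intro mult_dvd_mono) auto
    ultimately show ?thesis by (metis dvd_trans mult_1)
  next
    case False
    have "fact m * \<pp> ^ s dvd fact m * \<pp> ^ Suc s" by (intro mult_dvd_mono le_imp_power_dvd) auto
    then show ?thesis using tail[of m] False by (meson dvd_trans not_less)
  qed
  then obtain c where c': "\<And>m. \<pp> ^ m * C m = fact m * \<pp> ^ s * c m" unfolding dvd_def by metis
  then have c: "\<And>m. fact m * \<pp> ^ s * c m = \<pp> ^ m * C m" by simp
  have c_dvd: "\<pp> ^ k dvd c m \<longleftrightarrow> fact m * \<pp> ^ (s + k) dvd \<pp> ^ m * C m" for k m
    by (simp add: power_add mult.assoc flip: c)
  have "\<exists>N. \<forall>m\<ge>N. \<pp> ^ k dvd c m" for k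
    unfolding c_dvd by (rule conv)
  then obtain G where G: "G \<in> restricted_series"
    "\<And>k N. (\<And>m. m \<ge> N \<Longrightarrow> \<pp> ^ k dvd c m) \<Longrightarrow>
      fps_const (\<pp> ^ k) dvd G - fps_of_poly (\<Sum>m<N. Polynomial.smult (c m) (falling_poly m))"
    using binomial_series_restricted by blast
  let ?Q = "\<lambda>N. \<Sum>m<N. Polynomial.smult (c m) (falling_poly m)"
  let ?R = "\<Sum>m<d. Polynomial.smult (padic_reduce (c m)) (falling_poly m)"
  note lead = leading_poly_eq[OF d s(1) c]
  have "fps_const (\<pp> ^ 1) dvd G - fps_of_poly (?Q d)"
    by (rule G(2)) (use tail in \<open>simp only: c_dvd, simp\<close>)
  then have "series_reduce G = fps_of_poly (map_poly padic_reduce (?Q d))"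
    by (simp only: power_one_right series_reduce_of_poly[symmetric] series_reduce_eq_iff)
  moreover have "map_poly padic_reduce (?Q d) = ?R"
  proof -
    interpret mp: map_poly_comm_ring_hom "padic_reduce :: 'p padic_int \<Rightarrow> 'p mod_ring" ..
    show ?thesis
      by (simp add: mp.hom_sum padic_reduce.map_poly_hom_smult map_falling_poly padic_reduce.comm_ring_hom_axioms)
  qed
  ultimately have red: "series_reduce G = fps_of_poly (leading_poly d s C)" by (simp only: lead(1))
  have nz: "leading_poly d s C \<noteq> 0"
    using lead falling_poly_independent[of "\<lambda>m. padic_reduce (c m)" d] by auto
  have deg: "Polynomial.degree (leading_poly d s C) \<le> d - 1"
    unfolding lead(1)
  proof (rule degree_sum_le)
    fix m assume "m \<in> {..<d}"
    then show "Polynomial.degree (Polynomial.smult (padic_reduce (c m)) (falling_poly m)) \<le> d - 1"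
      by (intro Polynomial.degree_le) (auto simp: coeff_falling_poly)
  qed simp
  have "restricted_eval (fps_const (\<pp> ^ s) * G) t = F t" for t
  proof (rule restricted_eval_eqI)
    fix k
    obtain N0 where N0: "\<forall>m\<ge>N0. \<pp> ^ k dvd c m" using \<open>\<And>k. \<exists>N. \<forall>m\<ge>N. \<pp> ^ k dvd c m\<close> by blast
    \<comment> \<open>The first k terms fix F modulo \<open>p ^ k\<close>, and from
      \<open>N0\<close> on the coefficients \<open>c m\<close> vanish to that precision;
      \<open>N\<close> meets both demands.\<close>
    define N where "N = max k N0"
    let ?q = "Polynomial.smult (\<pp> ^ s) (?Q N)"
    have "fps_const (\<pp> ^ k) dvd fps_const (\<pp> ^ s) * (G - fps_of_poly (?Q N))"
      by (intro dvd_mult G(2)) (use N0 in \<open>simp add: N_def\<close>)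
    then have "fps_const (\<pp> ^ k) dvd fps_const (\<pp> ^ s) * G - fps_of_poly ?q"
      by (simp only: fps_of_poly_smult right_diff_distrib)
    moreover have "\<pp> ^ k dvd F t - poly ?q t"
    proof -
      have "\<pp> ^ s * (c m * poly (falling_poly m) t) = padic_binomial t m * (\<pp> ^ m * C m)" for m
        unfolding poly_falling_poly fact_mult_padic_binomial[symmetric] c[symmetric]
        by (simp only: mult_ac)
      then have "poly ?q t = (\<Sum>m<N. padic_binomial t m * (\<pp> ^ m * C m))"
        by (simp add: poly_sum sum_distrib_left)
      moreover have "\<pp> ^ k dvd (\<Sum>m<N. padic_binomial t m * (\<pp> ^ m * C m)) - F t"
        using F[where n = N and t = t] by (rule dvd_trans[rotated]) (simp add: le_imp_power_dvd N_def)
      ultimately show ?thesis by (simp only: dvd_diff_swap[of _ "F t"])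
    qed
    ultimately show "\<exists>q. fps_const (\<pp> ^ k) dvd fps_const (\<pp> ^ s) * G - fps_of_poly q \<and> \<pp> ^ k dvd F t - poly q t"
      by blast
  qed
  then show ?thesis using that G(1) red nz deg by blast
qed

section \<open>The trace of a binomial power\<close>

context
  fixes \<phi> :: "'p :: prime_card padic_int \<Rightarrow> 'a :: comm_ring_1" and B d U
  assumes A: "finite_free_algebra \<phi> B" and PB: "power_basis_algebra \<phi> d U"
begin

interpretation power_basis_algebra \<phi> d U by (rule PB)

lemma alg_trace_add: "alg_trace \<phi> (x + y) = alg_trace \<phi> x + alg_trace \<phi> y"
  by (simp add: alg_trace_eq_top[OF A] top_def cf_add distrib_left)

lemma alg_trace_scale: "alg_trace \<phi> (\<phi> r * x) = r * alg_trace \<phi> x"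
  by (simp add: alg_trace_eq_top[OF A] top_def mult.left_commute cf_scale)

lemma alg_trace_sum: "alg_trace \<phi> (\<Sum>i\<in>I. f i) = (\<Sum>i\<in>I. alg_trace \<phi> (f i))"
  by (simp add: alg_trace_eq_top[OF A] top_def sum_distrib_left cf_sum)

text \<open>Since (p U)^m is divisible by \<open>p ^ m\<close>, the first n terms determine the sum
  modulo \<open>p ^ n\<close>. The limit is formed coordinatewise in the powers of U, and linearity
  carries the congruence through the trace.\<close>

lemma trace_fun_approx:
  "\<pp> ^ n dvd (\<Sum>m<n. padic_binomial t m * (\<pp> ^ m * trace_coeff \<phi> y U m))
      - trace_fun \<phi> y (1 + of_nat CARD('p) * U) t"
proof -
  let ?p = "of_nat CARD('p) :: 'a"
  let ?g = "\<lambda>m. \<phi> (padic_binomial t m) * (1 + ?p * U - 1) ^ m"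
  let ?a = "\<lambda>i m. padic_binomial t m * cf (U ^ m) i"
  have g: "?g m = \<phi> (padic_binomial t m * \<pp> ^ m) * U ^ m" for m
    by (simp add: hom_mult hom_power hom_of_nat power_mult_distrib mult.assoc)
  have "\<exists>s. \<forall>K. \<pp> ^ K dvd s - (\<Sum>m<K. \<pp> ^ m * ?a i m)" for i
    by (rule padic_power_series_limit[of "?a i"]) blast
  then obtain s where s: "\<And>i K. \<pp> ^ K dvd s i - (\<Sum>m<K. \<pp> ^ m * ?a i m)"
    using choice[of "\<lambda>i s. \<forall>K. \<pp> ^ K dvd s - (\<Sum>m<K. \<pp> ^ m * ?a i m)"] by blast
  define S where "S = (\<Sum>i<d. \<phi> (s i) * U ^ i)"
  have S: "?p ^ K dvd (\<Sum>m<K. ?g m) - S" for K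
  proof -
    have "cf (\<Sum>m<K. ?g m) i = (\<Sum>m<K. \<pp> ^ m * ?a i m)" for i
      by (simp only: g cf_sum cf_scale) (simp add: mult_ac)
    then have "(\<Sum>m<K. ?g m) = (\<Sum>i<d. \<phi> (\<Sum>m<K. \<pp> ^ m * ?a i m) * U ^ i)"
      using cf_expansion[of "\<Sum>m<K. ?g m"] by (simp only:)
    then have "S - (\<Sum>m<K. ?g m) = (\<Sum>i<d. \<phi> (s i - (\<Sum>m<K. \<pp> ^ m * ?a i m)) * U ^ i)"
      by (simp only: S_def hom_minus left_diff_distrib sum_subtractf)
    also have "?p ^ K dvd \<dots>"
    proof (intro dvd_sum dvd_mult2)
      fix i
      obtain z where "s i - (\<Sum>m<K. \<pp> ^ m * ?a i m) = \<pp> ^ K * z" using s[of K i] by (auto simp: dvd_def)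
      then show "?p ^ K dvd \<phi> (s i - (\<Sum>m<K. \<pp> ^ m * ?a i m))"
        by (simp add: hom_mult hom_power hom_of_nat)
    qed
    finally show ?thesis by (simp only: dvd_diff_swap[of _ _ S])
  qed
  have "padic_sums CARD('p) ?g S"
    unfolding padic_sums_def
  proof (intro allI exI impI)
    fix k n :: nat assume "k \<le> n"
    then have "?p ^ k dvd ?p ^ n" by (rule le_imp_power_dvd)
    then show "?p ^ k dvd (\<Sum>m<n. ?g m) - S" using S[of n] by (rule dvd_trans)
  qed
  then have S_eq: "binomial_power \<phi> (1 + ?p * U) t = S"
    unfolding binomial_power_def
    by (intro padic_suminf_eqI) (rule finite_free_separated[OF A])
  obtain z where z: "(\<Sum>m<n. ?g m) - S = ?p ^ n * z" using S[of n] by (auto simp: dvd_def)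
  have "(\<Sum>m<n. y * ?g m) = y * S + \<phi> (\<pp> ^ n) * (y * z)"
  proof -
    have "(\<Sum>m<n. ?g m) = S + ?p ^ n * z" using z by (metis add_diff_cancel_left' add_diff_eq)
    then show ?thesis by (simp only: sum_distrib_left[symmetric]) (simp add: hom_power hom_of_nat algebra_simps)
  qed
  then have "alg_trace \<phi> (\<Sum>m<n. y * ?g m) = alg_trace \<phi> (y * S) + \<pp> ^ n * alg_trace \<phi> (y * z)"
    by (simp only: alg_trace_add alg_trace_scale)
  moreover have "alg_trace \<phi> (y * ?g m) = padic_binomial t m * (\<pp> ^ m * trace_coeff \<phi> y U m)" for m
  proof -
    have "y * ?g m = \<phi> (padic_binomial t m * \<pp> ^ m) * (y * U ^ m)" by (simp only: g mult.left_commute)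
    then show ?thesis by (simp only: alg_trace_scale trace_coeff_def mult.assoc)
  qed
  ultimately have "(\<Sum>m<n. padic_binomial t m * (\<pp> ^ m * trace_coeff \<phi> y U m))
      = trace_fun \<phi> y (1 + ?p * U) t + \<pp> ^ n * alg_trace \<phi> (y * z)"
    by (simp only: alg_trace_sum trace_fun_def S_eq)
  then show ?thesis by simp
qed

text \<open>For \<open>p = 2\<close> the valuation of \<open>2 ^ m / m!\<close> does not tend to infinity, which is why \<open>U\<close> has
  to be divisible by 2.\<close>

lemma trace_coeff_convergence:
  assumes two: "CARD('p) = 2 \<Longrightarrow> of_nat CARD('p) dvd U"
  shows "\<exists>N. \<forall>m\<ge>N. fact m * \<pp> ^ k dvd \<pp> ^ m * trace_coeff \<phi> y U m"
proof (cases "CARD('p) = 2")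
  case True
  \<comment> \<open>The factor 2 in U contributes a second \<open>2 ^ m\<close>, and m! can absorb
    only one of them because v(m!) \<le> m.\<close>
  obtain U' where U': "U = of_nat CARD('p) * U'" using two[OF True] by (auto simp: dvd_def)
  have "fact m * \<pp> ^ k dvd \<pp> ^ m * trace_coeff \<phi> y U m" if "m \<ge> k" for m
  proof -
    have "y * U ^ m = \<phi> (\<pp> ^ m) * (y * U' ^ m)"
      by (simp add: U' hom_power hom_of_nat power_mult_distrib mult_ac)
    then have "trace_coeff \<phi> y U m = \<pp> ^ m * alg_trace \<phi> (y * U' ^ m)"
      by (simp only: trace_coeff_def alg_trace_scale)
    then have eq: "\<pp> ^ m * trace_coeff \<phi> y U m = \<pp> ^ (m + m) * alg_trace \<phi> (y * U' ^ m)"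
      by (simp add: power_add mult.assoc)
    have "multiplicity CARD('p) (fact m) + 0 \<le> m"
      by (rule multiplicity_fact_add_le[OF prime_card]) auto
    then show ?thesis unfolding padic_fact_dvd_iff eq
      using that by (intro dvd_mult2 le_imp_power_dvd) simp
  qed
  then show ?thesis by blast
next
  case False
  \<comment> \<open>For odd p at most m / 2 of the m factors p are cancelled by m!, so m \<ge> 2 k
    leaves at least k.\<close>
  have "fact m * \<pp> ^ k dvd \<pp> ^ m * trace_coeff \<phi> y U m" if "m \<ge> 2 * k" for m
    unfolding padic_fact_dvd_iff
    using that multiplicity_fact_odd[OF prime_card False, of m]
    by (intro dvd_mult2 le_imp_power_dvd) simp
  then show ?thesis by blast
qed

end

text \<open>The Weierstrass multiplicity of a zero is its order as a root of \<open>W\<close>; the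
  count is asserted for every factorization, so that it does not hinge on a choice of
  \<open>W\<close>.\<close>

theorem theorem3p13:
  fixes \<phi> :: "'p :: prime_card padic_int \<Rightarrow> 'a :: comm_ring_1"
    and d P :: nat and \<eta> \<gamma> U y :: 'a and a :: int
    and C :: "nat \<Rightarrow> 'p padic_int" and F :: "'p padic_int \<Rightarrow> 'p padic_int"
  assumes etale: "finite_etale_of_rank \<phi> d"
    and p_gt_d: "d < CARD('p)"
    and unit: "\<eta> dvd 1"
    and P: "P = residue_order CARD('p) \<eta>"
    and U: "\<eta> ^ P = 1 + of_nat CARD('p) * U"
    and two: "CARD('p) = 2 \<longrightarrow> residue_class CARD('p) U = residue_class CARD('p) 0"
    and y: "y = \<gamma> * unit_power_int \<eta> a"
    and nonzero: "residue_class CARD('p) y \<noteq> residue_class CARD('p) 0"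
    and basis: "residue_basis TYPE('p) d (\<lambda>i. U ^ i)"
    and C: "C = trace_coeff \<phi> y U"
    and F: "F = trace_fun \<phi> y (\<eta> ^ P)"
  shows "\<exists>s \<Phi> FX.
    min_slope d C = enat s \<and> 0 \<le> s \<and> s \<le> d - 1 \<and>
    \<Phi> = leading_poly d s C \<and>
    FX \<in> restricted_series \<and> (\<forall>t. restricted_eval FX t = F t) \<and>
    (\<exists>G \<in> restricted_series. FX = fps_const (of_nat CARD('p) ^ s) * G \<and>
       series_reduce G = fps_of_poly \<Phi> \<and> \<Phi> \<noteq> 0) \<and>
    Polynomial.degree \<Phi> \<le> d - 1 \<and>
    (\<exists>W V. weierstrass_factorization FX s (Polynomial.degree \<Phi>) W V) \<and>
    (\<forall>W V. weierstrass_factorization FX s (Polynomial.degree \<Phi>) W V \<longrightarrow>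
       finite {t. F t = 0} \<and> (\<Sum>t | F t = 0. Polynomial.order t W) \<le> d - 1) \<and>
    (\<forall>\<rho>. Polynomial.order \<rho> \<Phi> = 1 \<longrightarrow>
       (\<exists>\<tau>. padic_reduce \<tau> = \<rho> \<and> F \<tau> = 0 \<and>
          (\<forall>\<tau>'. padic_reduce \<tau>' = \<rho> \<and> F \<tau>' = 0 \<longrightarrow> \<tau>' = \<tau>) \<and>
          (\<forall>t. padic_reduce t = \<rho> \<longrightarrow> padic_val (F t) = enat s + padic_val (t - \<tau>))))"
proof -
  obtain B where A: "finite_free_algebra \<phi> B"
    using etale unfolding finite_etale_of_rank_def finite_free_algebra_def finite_free_algebra_axioms_def
    by blast
  have kaehler: "kaehler_differentials_vanish \<phi>" using etale by (simp add: finite_etale_of_rank_def)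
  have y0: "\<not> of_nat CARD('p) dvd y" using nonzero by (simp add: residue_class_eq_iff)
  have d: "0 < d"
  proof (rule ccontr)
    assume "\<not> 0 < d"
    then have "y = 0" using residue_basis_span[OF A basis, of y] by simp
    then show False using y0 by simp
  qed
  have PB: "power_basis_algebra \<phi> d U"
    using A d residue_basis_span[OF A basis] residue_basis_independent[OF A basis]
    unfolding power_basis_algebra_def power_basis_algebra_axioms_def finite_free_algebra_def by blast
  \<comment> \<open>Were all these traces divisible by p, so would be y. The index \<open>m0\<close>
    of a unit coefficient bounds the slope: s \<le> m0 < d.\<close>
  obtain m0 where m0: "m0 < d" "\<not> \<pp> dvd C m0"
    using finite_etale_trace_nondegenerate[OF A PB kaehler, of y] y0 by (auto simp: C trace_coeff_def)
  have "min_slope d C \<le> enat m0 + padic_val (C m0)"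
    unfolding min_slope_def using m0 by (intro Min_le) auto
  also have "\<dots> = enat m0" using m0 by (simp add: padic_val_unit padic_unit_iff)
  finally obtain s where s: "min_slope d C = enat s" "s < d"
    using m0 by (cases "min_slope d C") auto
  have "CARD('p) = 2 \<Longrightarrow> of_nat CARD('p) dvd U" using two by (simp add: residue_class_eq_iff)
  then have conv: "\<exists>N. \<forall>m\<ge>N. fact m * \<pp> ^ k dvd \<pp> ^ m * C m" for k
    unfolding C by (rule trace_coeff_convergence[OF A PB])
  have approx: "\<pp> ^ n dvd (\<Sum>m<n. padic_binomial t m * (\<pp> ^ m * C m)) - F t" for t n
    unfolding C F U by (rule trace_fun_approx[OF A PB])
  define \<Phi> where "\<Phi> = leading_poly d s C"
  obtain G where G: "G \<in> restricted_series" and red: "series_reduce G = fps_of_poly \<Phi>"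
    and nz: "\<Phi> \<noteq> 0" and deg: "Polynomial.degree \<Phi> \<le> d - 1"
    and eval: "\<And>t. restricted_eval (fps_const (\<pp> ^ s) * G) t = F t"
    using binomial_series_weierstrass[OF d p_gt_d s conv approx] unfolding \<Phi>_def by blast
  define FX where "FX = fps_const (\<pp> ^ s) * G"
  have const: "fps_const (\<pp> ^ s) \<in> (restricted_series :: 'p padic_int fps set)"
    by (metis fps_of_poly_const restricted_of_poly)
  have FX: "FX \<in> restricted_series" unfolding FX_def by (rule restricted_mult[OF const G])
  have evalFX: "restricted_eval FX t = F t" for t using eval by (simp add: FX_def)
  have eval_G: "F t = \<pp> ^ s * restricted_eval G t" for t
  proof -
    have "restricted_eval (fps_const (\<pp> ^ s)) t = \<pp> ^ s"
      using restricted_eval_of_poly[of "[:\<pp> ^ s:]" t] unfolding fps_of_poly_const by simp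
    then show ?thesis using restricted_eval_mult[OF const G, of t] eval[of t] by simp
  qed
  have "\<exists>W V. weierstrass_factorization FX s (Polynomial.degree \<Phi>) W V"
    using weierstrass_preparation[OF G red nz]
    unfolding weierstrass_factorization_def FX_def by (metis mult.assoc)
  moreover have "finite {t. F t = 0} \<and> (\<Sum>t | F t = 0. Polynomial.order t W) \<le> d - 1"
    if "weierstrass_factorization FX s (Polynomial.degree \<Phi>) W V" for W V
    using weierstrass_zeros(3,4)[OF that] deg unfolding evalFX by auto
  moreover have "\<exists>\<tau>. padic_reduce \<tau> = \<rho> \<and> F \<tau> = 0 \<and>
          (\<forall>\<tau>'. padic_reduce \<tau>' = \<rho> \<and> F \<tau>' = 0 \<longrightarrow> \<tau>' = \<tau>) \<and>
          (\<forall>t. padic_reduce t = \<rho> \<longrightarrow> padic_val (F t) = enat s + padic_val (t - \<tau>))"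
    if "Polynomial.order \<rho> \<Phi> = 1" for \<rho>
  proof -
    obtain \<tau> where \<tau>: "padic_reduce \<tau> = \<rho>"
      "\<And>t. padic_reduce t = \<rho> \<Longrightarrow> padic_val (restricted_eval G t) = padic_val (t - \<tau>)"
      using restricted_simple_root[OF G red nz \<open>Polynomial.order \<rho> \<Phi> = 1\<close>] by blast
    have val: "padic_val (F t) = enat s + padic_val (t - \<tau>)" if "padic_reduce t = \<rho>" for t
      using \<tau>(2)[OF that] by (simp add: eval_G padic_val_mult)
    have val_inf: "padic_val x = \<infinity> \<longleftrightarrow> x = 0" for x :: "'p padic_int"
      by (simp add: padic_val_def)
    \<comment> \<open>Infinite valuation characterises 0, so the valuation formula alone shows that
      \<tau> is a zero and the only one in its residue class.\<close>
    have "F t = 0 \<longleftrightarrow> t = \<tau>" if "padic_reduce t = \<rho>" for t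
      using val[OF that] val_inf[of "F t"] val_inf[of "t - \<tau>"]
      by (cases "padic_val (t - \<tau>)") auto
    then show ?thesis using \<tau>(1) val by blast
  qed
  ultimately show ?thesis
    using s G red nz deg FX evalFX FX_def \<Phi>_def
    by (intro exI[of _ s] exI[of _ \<Phi>] exI[of _ FX]) auto
qed

end
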